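(* Let $f:\mathbb{N}\to\mathbb{C}$ be any small arithmetic function and let $T\ge 10$ be a large parameter. Then for every $\varepsilon>0$, $$\int_T^{2T}|E_f(x)|^2\,dx\ll_{f,\varepsilon} T^{9/5+\varepsilon}.$$
   Context: $\mathbb{N}$ is the set of positive integers and $[t]$ is the integer part of $t$. An arithmetic function $f:\mathbb{N}\to\mathbb{C}$ is called small if $f(n)\ll n^{\varepsilon}$ for every $\varepsilon>0$ (implied constant depending on $f$ and $\varepsilon$). For $x\ge 1$ put $$S_f(x):=\sum_{n\le x}f([x/n]),\qquad C_f:=\sum_{n=1}^\infty\frac{f(n)}{n(n+1)},\qquad E_f(x):=S_f(x)-C_fx.$$ *)

theory Defs
  imports "HOL-Analysis.Analysis"
begin

text \<open>
  Arithmetic functions live on the positive integers; they are represented as functions on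
  \<^typ>\<open>nat\<close> whose value at \<open>0\<close> is never used.
\<close>

definition small_arith :: "(nat \<Rightarrow> complex) \<Rightarrow> bool" where
  "small_arith f \<longleftrightarrow>
     (\<forall>\<epsilon>::real. \<epsilon> > 0 \<longrightarrow> (\<exists>K::real. \<forall>n\<ge>1. norm (f n) \<le> K * real n powr \<epsilon>))"

definition S_sum :: "(nat \<Rightarrow> complex) \<Rightarrow> real \<Rightarrow> complex" where
  "S_sum f x = (\<Sum>n | 1 \<le> n \<and> real n \<le> x. f (nat \<lfloor>x / real n\<rfloor>))"

(* Shifted index: the term at m is the term n = m + 1 of the sum over n >= 1. *)
definition C_const :: "(nat \<Rightarrow> complex) \<Rightarrow> complex" where
  "C_const f = (\<Sum>m. f (m + 1) / (of_nat (m + 1) * of_nat (m + 2)))"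

definition E_err :: "(nat \<Rightarrow> complex) \<Rightarrow> real \<Rightarrow> complex" where
  "E_err f x = S_sum f x - C_const f * of_real x"

end

theory Submission
  imports Defs
begin

text \<open>
  Grouping the \<open>n\<close> with \<open>[x/n] = d\<close> for \<open>d \<le> D\<close> and bounding the remaining \<open>O(T/D)\<close> terms trivially
  leaves \<open>\<Sum>\<^bsub>d \<le> D\<^esub> f(d) (\<psi>(x/(d+1)) - \<psi>(x/d))\<close>. Since \<open>[x/d]\<close> only depends on \<open>[x]\<close>, it is enough
  to average over integers \<open>N\<close>, where \<open>\<psi>(N/d)\<close> has a finite Fourier expansion with
  frequencies \<open>h/d\<close> and no convergence question arises. After reducing fractions, the frequencies
  are Farey fractions of order \<open>D\<close>, which are spaced by \<open>1/D\<^sup>2\<close>; the dual large sieve bounds the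
  mean square over an interval of length \<open>T \<le> D\<^sup>2\<close> by \<open>D\<^sup>2\<close> times the \<open>\<ell>\<^sup>2\<close>-norm \<open>D T\<^sup>\<epsilon>\<close> of
  the coefficients. The resulting \<open>D\<^sup>3 + T (T/D)\<^sup>2\<close> is balanced by \<open>D = T\<^bsup>3/5\<^esup>\<close>.
\<close>

section \<open>The dual large sieve\<close>

definition e1 :: "real \<Rightarrow> complex" where
  "e1 t = cis (2 * pi * t)"

lemma e1_add: "e1 (s + t) = e1 s * e1 t"
  by (simp add: e1_def cis_mult algebra_simps)

lemma cnj_e1: "cnj (e1 t) = e1 (- t)"
  by (simp add: e1_def cis_cnj)

lemma norm_e1 [simp]: "norm (e1 t) = 1"
  by (simp add: e1_def)

lemma e1_of_int [simp]: "e1 (of_int k) = 1"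
  by (simp add: e1_def)

lemma e1_of_nat [simp]: "e1 (of_nat k) = 1"
  using e1_of_int[of "int k"] by simp

lemma e1_power: "e1 t ^ n = e1 (real n * t)"
  unfolding e1_def Complex.DeMoivre by (simp add: mult_ac)

lemma e1_frac: "e1 (frac t) = e1 t"
  using e1_add[of "frac t" "of_int \<lfloor>t\<rfloor>"] by (simp add: frac_def)

lemma norm_e1_minus_1: "norm (e1 t - 1) = 2 * \<bar>sin (pi * t)\<bar>"
proof -
  have "(norm (e1 t - 1))\<^sup>2 = (cos (2 * pi * t) - 1)\<^sup>2 + (sin (2 * pi * t))\<^sup>2"
    by (simp add: cmod_power2 e1_def)
  also have "\<dots> = 2 - 2 * cos (2 * pi * t)"
    using sin_cos_squared_add[of "2 * pi * t"] by (simp add: power2_eq_square algebra_simps)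
  also have "\<dots> = (2 * \<bar>sin (pi * t)\<bar>)\<^sup>2"
    using cos_double_sin[of "pi * t"] by (simp add: power_mult_distrib mult.assoc)
  finally show ?thesis
    by (metis abs_ge_zero norm_ge_zero mult_nonneg_nonneg power2_eq_iff_nonneg zero_le_numeral)
qed

text \<open>Concavity of the sine: its graph lies above the chord from 0 to pi/2.\<close>

lemma sin_pi_ge:
  assumes "0 \<le> t" "t \<le> 1 / 2"
  shows "sin (pi * t) \<ge> 2 * t"
proof -
  have "convex_on {0..pi} (\<lambda>x::real. - sin x)"
  proof (rule f''_ge0_imp_convex)
    show "((\<lambda>x. - sin x) has_real_derivative - cos x) (at x)" for x :: real
      by (auto intro!: derivative_eq_intros)
    show "((\<lambda>x. - cos x) has_real_derivative sin x) (at x)" for x :: real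
      by (auto intro!: derivative_eq_intros)
  qed (auto simp: sin_ge_zero)
  from convex_onD[OF this, of "2 * t" 0 "pi / 2"] show ?thesis
    using assms by (simp add: algebra_simps)
qed

text \<open>The chord \<open>norm (e1 t - 1)\<close> is at least four times the distance from
  \<open>t\<close> to the nearer of 0 and 1. Adding the contributions of both endpoints lets a sum
  over spaced \<open>t\<close> split into two sums of the same shape.\<close>

lemma inverse_norm_e1_minus_1:
  assumes "0 < t" "t < 1"
  shows "1 / (norm (e1 t - 1))\<^sup>2 \<le> (1 / t\<^sup>2 + 1 / (1 - t)\<^sup>2) / 16"
proof -
  have *: "1 / (norm (e1 t - 1))\<^sup>2 \<le> 1 / s\<^sup>2 / 16"
    if "0 < s" "4 * s \<le> norm (e1 t - 1)" for s
  proof -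
    have "1 / (norm (e1 t - 1))\<^sup>2 \<le> 1 / (4 * s)\<^sup>2"
      using that by (intro divide_left_mono power_mono mult_pos_pos zero_less_power) auto
    then show ?thesis by (simp add: power_mult_distrib)
  qed
  show ?thesis
  proof (cases "t \<le> 1 / 2")
    case True
    have "4 * t \<le> norm (e1 t - 1)"
      using sin_pi_ge[of t] assms True by (simp add: norm_e1_minus_1)
    from *[OF _ this] have "1 / (norm (e1 t - 1))\<^sup>2 \<le> 1 / t\<^sup>2 / 16"
      using assms by simp
    also have "\<dots> \<le> (1 / t\<^sup>2 + 1 / (1 - t)\<^sup>2) / 16"
      by (simp add: divide_right_mono)
    finally show ?thesis .
  next
    case False
    have "sin (pi * (1 - t)) = sin (pi * t)"
      by (simp add: right_diff_distrib sin_diff)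
    then have "4 * (1 - t) \<le> norm (e1 t - 1)"
      using sin_pi_ge[of "1 - t"] assms False by (simp add: norm_e1_minus_1)
    from *[OF _ this] have "1 / (norm (e1 t - 1))\<^sup>2 \<le> 1 / (1 - t)\<^sup>2 / 16"
      using assms by simp
    also have "\<dots> \<le> (1 / t\<^sup>2 + 1 / (1 - t)\<^sup>2) / 16"
      by (simp add: divide_right_mono)
    finally show ?thesis .
  qed
qed

lemma e1_minus_1_nonzero:
  assumes "0 < t" "t < 1"
  shows "e1 t \<noteq> 1"
proof -
  have "sin (pi * t) > 0"
    using assms by (intro sin_gt_zero) auto
  then have "norm (e1 t - 1) > 0" by (simp add: norm_e1_minus_1)
  then show ?thesis by auto
qed

section \<open>Reciprocal squares over spaced points, and geometric sums\<close>

lemma sum_inverse_squares_le: "(\<Sum>j=1..n. 1 / (real j)\<^sup>2) \<le> 2"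
proof -
  \<comment> \<open>The subtracted \<open>1 / real (Suc n)\<close> lets the induction close: the new
    term is at most 1/((n+1)(n+2)), which telescopes.\<close>
  have "(\<Sum>j=1..Suc n. 1 / (real j)\<^sup>2) \<le> 2 - 1 / real (Suc n)" for n
  proof (induction n)
    case (Suc n)
    have "1 / (real n + 2)\<^sup>2 \<le> 1 / ((real n + 1) * (real n + 2))"
      by (intro divide_left_mono) (auto simp: power2_eq_square)
    also have "\<dots> = 1 / (real n + 1) - 1 / (real n + 2)"
      by (simp add: divide_simps)
    finally show ?case using Suc by (simp add: add_ac)
  qed simp
  from order_trans[OF this] show ?thesis
    by (cases n) simp_all
qed

text \<open>Rounding \<open>t r / \<delta>\<close> down sends distinct points to distinct positive
  integers, because two points in one cell of length \<delta> would violate the spacing. The sum is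
  then dominated by a sum of 1/j^2 over integers.\<close>

lemma sum_inverse_squares_spaced:
  fixes t :: "'a \<Rightarrow> real"
  assumes fin: "finite A" and \<delta>: "\<delta> > 0"
    and ge: "\<And>r. r \<in> A \<Longrightarrow> t r \<ge> \<delta>"
    and sep: "\<And>r s. r \<in> A \<Longrightarrow> s \<in> A \<Longrightarrow> r \<noteq> s \<Longrightarrow> \<bar>t r - t s\<bar> \<ge> \<delta>"
  shows "(\<Sum>r\<in>A. 1 / (t r)\<^sup>2) \<le> 2 / \<delta>\<^sup>2"
proof -
  define j where "j r = nat \<lfloor>t r / \<delta>\<rfloor>" for r
  have j1: "1 \<le> j r" "real (j r) * \<delta> \<le> t r" "t r < (real (j r) + 1) * \<delta>" if "r \<in> A" for r
  proof -
    have "1 \<le> t r / \<delta>" using ge[OF that] \<delta> by simp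
    then have 1: "1 \<le> \<lfloor>t r / \<delta>\<rfloor>" by linarith
    then show "1 \<le> j r" unfolding j_def by linarith
    have 2: "real (j r) = of_int \<lfloor>t r / \<delta>\<rfloor>" using 1 by (simp add: j_def)
    have "real (j r) \<le> t r / \<delta>" unfolding 2 by linarith
    then show "real (j r) * \<delta> \<le> t r" using \<delta> by (simp add: pos_le_divide_eq)
    have "t r / \<delta> < real (j r) + 1" unfolding 2 by linarith
    then show "t r < (real (j r) + 1) * \<delta>" using \<delta> by (simp add: pos_divide_less_eq)
  qed
  have inj: "inj_on j A"
  proof (rule inj_onI, rule ccontr)
    fix r s assume rs: "r \<in> A" "s \<in> A" "j r = j s" "r \<noteq> s"
    have "\<bar>t r - t s\<bar> < \<delta>"
      using j1(2,3)[OF rs(1)] j1(2,3)[OF rs(2)] rs(3) by (simp add: algebra_simps abs_less_iff)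
    with sep[OF rs(1,2,4)] show False by simp
  qed
  have "(\<Sum>r\<in>A. 1 / (t r)\<^sup>2) \<le> (\<Sum>r\<in>A. 1 / (real (j r))\<^sup>2 / \<delta>\<^sup>2)"
  proof (rule sum_mono)
    fix r assume r: "r \<in> A"
    have "1 / (t r)\<^sup>2 \<le> 1 / (real (j r) * \<delta>)\<^sup>2"
      using j1(1,2)[OF r] ge[OF r] \<delta> by (intro divide_left_mono power_mono mult_pos_pos) auto
    then show "1 / (t r)\<^sup>2 \<le> 1 / (real (j r))\<^sup>2 / \<delta>\<^sup>2" by (simp add: power_mult_distrib)
  qed
  also have "\<dots> = (\<Sum>k\<in>j ` A. 1 / (real k)\<^sup>2) / \<delta>\<^sup>2"
    using inj by (simp add: sum.reindex sum_divide_distrib)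
  also have "\<dots> \<le> (\<Sum>k=1..Max (insert 1 (j ` A)). 1 / (real k)\<^sup>2) / \<delta>\<^sup>2"
    using fin j1(1) by (intro divide_right_mono sum_mono2) auto
  also have "\<dots> \<le> 2 / \<delta>\<^sup>2"
    by (intro divide_right_mono sum_inverse_squares_le) auto
  finally show ?thesis .
qed

text \<open>The numerator in the closed form of the geometric sum is at most 2, so the bound does
  not depend on the number of terms.\<close>

lemma norm_geometric_sum_e1_le:
  assumes "0 < t" "t < 1"
  shows "(norm (\<Sum>i<R. e1 (real i * t)))\<^sup>2 \<le> (1 / t\<^sup>2 + 1 / (1 - t)\<^sup>2) / 4"
proof -
  have "norm (\<Sum>i<R. e1 (real i * t)) = norm (1 - e1 (real R * t)) / norm (1 - e1 t)"
    using e1_minus_1_nonzero[OF assms] by (simp flip: e1_power add: sum_gp_strict norm_divide)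
  also have "\<dots> \<le> 2 / norm (1 - e1 t)"
    using norm_triangle_ineq4[of 1 "e1 (real R * t)"] by (intro divide_right_mono) auto
  finally have "(norm (\<Sum>i<R. e1 (real i * t)))\<^sup>2 \<le> (2 / norm (1 - e1 t))\<^sup>2"
    by (intro power_mono) auto
  also have "\<dots> = 4 * (1 / (norm (e1 t - 1))\<^sup>2)"
    by (simp add: power_divide norm_minus_commute)
  finally show ?thesis using inverse_norm_e1_minus_1[OF assms] by simp
qed

lemma sum_swap4:
  "(\<Sum>j\<in>J. \<Sum>i\<in>I. \<Sum>p\<in>P. \<Sum>r\<in>R. f i j p r) = (\<Sum>p\<in>P. \<Sum>r\<in>R. \<Sum>i\<in>I. \<Sum>j\<in>J. f i j p r)"
proof -
  have "(\<Sum>j\<in>J. \<Sum>i\<in>I. \<Sum>p\<in>P. \<Sum>r\<in>R. f i j p r) = (\<Sum>i\<in>I. \<Sum>j\<in>J. \<Sum>p\<in>P. \<Sum>r\<in>R. f i j p r)"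
    by (rule sum.swap)
  also have "\<dots> = (\<Sum>i\<in>I. \<Sum>p\<in>P. \<Sum>j\<in>J. \<Sum>r\<in>R. f i j p r)"
    by (intro sum.cong refl sum.swap)
  also have "\<dots> = (\<Sum>p\<in>P. \<Sum>i\<in>I. \<Sum>j\<in>J. \<Sum>r\<in>R. f i j p r)"
    by (rule sum.swap)
  also have "\<dots> = (\<Sum>p\<in>P. \<Sum>i\<in>I. \<Sum>r\<in>R. \<Sum>j\<in>J. f i j p r)"
    by (intro sum.cong refl sum.swap)
  also have "\<dots> = (\<Sum>p\<in>P. \<Sum>r\<in>R. \<Sum>i\<in>I. \<Sum>j\<in>J. f i j p r)"
    by (intro sum.cong refl sum.swap)
  finally show ?thesis .
qed

text \<open>
  Averaging the mean square over all shifts \<open>i - j\<close> with \<open>i, j < 2Q\<close> replaces the sharp cutoff by the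
  Fejer kernel \<open>\<bar>G\<bar>\<^sup>2\<close>, whose quadratic decay makes the row sums converge.
\<close>

lemma large_sieve_dual:
  fixes \<theta> :: "'a \<Rightarrow> real" and a :: "'a \<Rightarrow> complex"
  assumes fin: "finite P" and \<delta>: "\<delta> > 0" and Q: "1 / \<delta> \<le> real Q"
    and sep: "\<And>p r k. p \<in> P \<Longrightarrow> r \<in> P \<Longrightarrow> p \<noteq> r \<Longrightarrow> \<bar>\<theta> p - \<theta> r - of_int k\<bar> \<ge> \<delta>"
  shows "(\<Sum>n<Q. (norm (\<Sum>p\<in>P. a p * e1 (\<theta> p * (y + real n))))\<^sup>2)
           \<le> 5 * real Q * (\<Sum>p\<in>P. (norm (a p))\<^sup>2)"
proof -
  define S where "S x = (\<Sum>p\<in>P. a p * e1 (\<theta> p * x))" for x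
  define G where "G \<beta> = (\<Sum>i<2 * Q. e1 (real i * \<beta>))" for \<beta>
  define M where "M = (\<Sum>p\<in>P. (norm (a p))\<^sup>2)"
  have Q0: "real Q > 0"
    using Q \<delta> by (meson divide_pos_pos less_le_trans zero_less_one)

  \<comment> \<open>The diagonal term is (2Q)^2; the spaced off-diagonal terms add up to at most
    (1/\<delta>)^2 \<le> Q^2.\<close>
  have row: "(\<Sum>r\<in>P. (norm (G (\<theta> r - \<theta> p)))\<^sup>2) \<le> 5 * (real Q)\<^sup>2" if p: "p \<in> P" for p
  proof -
    define t where "t r = frac (\<theta> r - \<theta> p)" for r
    have shift: "\<exists>k. t r = \<theta> r - \<theta> p - of_int k" for r
      by (auto simp: t_def frac_def)
    have t: "\<delta> \<le> t r" "\<delta> \<le> 1 - t r" if r: "r \<in> P - {p}" for r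
    proof -
      obtain k where k: "t r = \<theta> r - \<theta> p - of_int k" using shift by blast
      have "0 \<le> t r" "t r < 1" by (auto simp: t_def frac_lt_1)
      \<comment> \<open>The shifts \<open>k\<close> and \<open>k + 1\<close> give the distances to
        the endpoints 0 and 1.\<close>
      then show "\<delta> \<le> t r" "\<delta> \<le> 1 - t r"
        using sep[of r p k] sep[of r p "k + 1"] r p k by auto
    qed
    have tt: "\<delta> \<le> \<bar>t r - t s\<bar>" if "r \<in> P" "s \<in> P" "r \<noteq> s" for r s
    proof -
      obtain k l where "t r = \<theta> r - \<theta> p - of_int k" "t s = \<theta> s - \<theta> p - of_int l"
        using shift by metis
      then show ?thesis using sep[OF that, of "k - l"] by (simp add: algebra_simps)
    qed
    have "(\<Sum>r\<in>P - {p}. (norm (G (\<theta> r - \<theta> p)))\<^sup>2)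
          \<le> (\<Sum>r\<in>P - {p}. (1 / (t r)\<^sup>2 + 1 / (1 - t r)\<^sup>2) / 4)"
    proof (rule sum_mono)
      fix r assume r: "r \<in> P - {p}"
      have "e1 (real i * (\<theta> r - \<theta> p)) = e1 (real i * t r)" for i
        by (simp flip: e1_power add: t_def e1_frac)
      then have "G (\<theta> r - \<theta> p) = (\<Sum>i<2 * Q. e1 (real i * t r))"
        by (simp add: G_def)
      then show "(norm (G (\<theta> r - \<theta> p)))\<^sup>2 \<le> (1 / (t r)\<^sup>2 + 1 / (1 - t r)\<^sup>2) / 4"
        using norm_geometric_sum_e1_le[of "t r" "2 * Q"] t[OF r] \<delta> by simp
    qed
    also have "\<dots> = ((\<Sum>r\<in>P - {p}. 1 / (t r)\<^sup>2) + (\<Sum>r\<in>P - {p}. 1 / (1 - t r)\<^sup>2)) / 4"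
      by (simp add: sum.distrib flip: sum_divide_distrib)
    also have "\<dots> \<le> (2 / \<delta>\<^sup>2 + 2 / \<delta>\<^sup>2) / 4"
      using fin \<delta> t tt
      by (intro divide_right_mono add_mono sum_inverse_squares_spaced)
         (auto simp: abs_minus_commute)
    also have "\<dots> = (1 / \<delta>)\<^sup>2" by (simp add: power_divide)
    also have "\<dots> \<le> (real Q)\<^sup>2" using Q \<delta> by (intro power_mono) auto
    finally have "(\<Sum>r\<in>P - {p}. (norm (G (\<theta> r - \<theta> p)))\<^sup>2) \<le> (real Q)\<^sup>2" .
    moreover have "G (\<theta> p - \<theta> p) = of_nat (2 * Q)"
      using e1_of_nat[of 0] by (simp add: G_def)
    then have "(norm (G (\<theta> p - \<theta> p)))\<^sup>2 = 4 * (real Q)\<^sup>2"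
      by (simp only: norm_of_nat) (simp add: power_mult_distrib)
    ultimately show ?thesis
      using sum.remove[OF fin p, of "\<lambda>r. (norm (G (\<theta> r - \<theta> p)))\<^sup>2"] by linarith
  qed

  \<comment> \<open>After expanding the square, \<open>i\<close> and \<open>j\<close> separate in
    the phase, so summing over both yields \<open>G\<close> times its conjugate. The total is real
    and nonnegative, hence it is recovered below as a norm.\<close>
  have "complex_of_real (\<Sum>j<2 * Q. \<Sum>i<2 * Q. (norm (S (y + real i - real j)))\<^sup>2)
      = (\<Sum>j<2 * Q. \<Sum>i<2 * Q. \<Sum>p\<in>P. \<Sum>r\<in>P. a p * cnj (a r) * e1 ((\<theta> p - \<theta> r) * y) *
           (e1 (real i * (\<theta> p - \<theta> r)) * cnj (e1 (real j * (\<theta> p - \<theta> r)))))"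
  proof -
    have phase: "e1 (\<theta> p * (y + real i - real j)) * cnj (e1 (\<theta> r * (y + real i - real j)))
        = e1 ((\<theta> p - \<theta> r) * y) * (e1 (real i * (\<theta> p - \<theta> r)) * cnj (e1 (real j * (\<theta> p - \<theta> r))))"
      for i j p r
      by (simp flip: e1_add add: cnj_e1) (simp add: algebra_simps)
    have "S (y + real i - real j) * cnj (S (y + real i - real j))
        = (\<Sum>p\<in>P. \<Sum>r\<in>P. a p * cnj (a r) * e1 ((\<theta> p - \<theta> r) * y) *
           (e1 (real i * (\<theta> p - \<theta> r)) * cnj (e1 (real j * (\<theta> p - \<theta> r)))))" for i j
      unfolding S_def cnj_sum sum_product complex_cnj_mult
    proof (intro sum.cong refl)
      fix p r
      let ?e = "e1 (\<theta> p * (y + real i - real j))" and ?e' = "cnj (e1 (\<theta> r * (y + real i - real j)))"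
      have "a p * ?e * (cnj (a r) * ?e') = a p * cnj (a r) * (?e * ?e')"
        by (simp only: mult_ac)
      also have "\<dots> = a p * cnj (a r) * e1 ((\<theta> p - \<theta> r) * y) *
           (e1 (real i * (\<theta> p - \<theta> r)) * cnj (e1 (real j * (\<theta> p - \<theta> r))))"
        unfolding phase by (simp only: mult.assoc)
      finally show "a p * ?e * (cnj (a r) * ?e') = a p * cnj (a r) * e1 ((\<theta> p - \<theta> r) * y) *
           (e1 (real i * (\<theta> p - \<theta> r)) * cnj (e1 (real j * (\<theta> p - \<theta> r))))" .
    qed
    then show ?thesis
      by (simp only: of_real_sum complex_norm_square)
  qed
  also have "\<dots> = (\<Sum>p\<in>P. \<Sum>r\<in>P. \<Sum>i<2 * Q. \<Sum>j<2 * Q.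
       a p * cnj (a r) * e1 ((\<theta> p - \<theta> r) * y) *
           (e1 (real i * (\<theta> p - \<theta> r)) * cnj (e1 (real j * (\<theta> p - \<theta> r)))))"
    by (rule sum_swap4)
  also have "\<dots> = (\<Sum>p\<in>P. \<Sum>r\<in>P. a p * cnj (a r) * e1 ((\<theta> p - \<theta> r) * y) *
                   (G (\<theta> p - \<theta> r) * cnj (G (\<theta> p - \<theta> r))))"
    unfolding G_def cnj_sum sum_product by (simp only: sum_distrib_left)
  finally have "(\<Sum>j<2 * Q. \<Sum>i<2 * Q. (norm (S (y + real i - real j)))\<^sup>2)
      = norm (\<Sum>p\<in>P. \<Sum>r\<in>P. a p * cnj (a r) * e1 ((\<theta> p - \<theta> r) * y) *
                   (G (\<theta> p - \<theta> r) * cnj (G (\<theta> p - \<theta> r))))"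
    by (metis (no_types, lifting) norm_of_real abs_of_nonneg sum_nonneg zero_le_power2)
  also have "\<dots> \<le> (\<Sum>p\<in>P. \<Sum>r\<in>P. norm (a p) * norm (a r) * (norm (G (\<theta> p - \<theta> r)))\<^sup>2)"
    by (intro sum_norm_le order_trans[OF norm_sum] sum_mono)
       (simp add: norm_mult power2_eq_square)
  \<comment> \<open>A Schur test: AM-GM decouples \<open>a p\<close> from \<open>a r\<close>, and
    since \<open>norm (G \<beta>)\<close> is even in \<beta> both halves reduce to the same row
    sums.\<close>
  also have "\<dots> \<le> (\<Sum>p\<in>P. \<Sum>r\<in>P. ((norm (a p))\<^sup>2 + (norm (a r))\<^sup>2) / 2 * (norm (G (\<theta> p - \<theta> r)))\<^sup>2)"
  proof (intro sum_mono mult_right_mono)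
    show "norm (a p) * norm (a r) \<le> ((norm (a p))\<^sup>2 + (norm (a r))\<^sup>2) / 2" for p r
      using sum_squares_bound[of "norm (a p)" "norm (a r)"] by simp
  qed auto
  also have "\<dots> = (\<Sum>p\<in>P. \<Sum>r\<in>P. (norm (a p))\<^sup>2 / 2 * (norm (G (\<theta> p - \<theta> r)))\<^sup>2)
                + (\<Sum>p\<in>P. \<Sum>r\<in>P. (norm (a r))\<^sup>2 / 2 * (norm (G (\<theta> p - \<theta> r)))\<^sup>2)"
    by (simp add: sum.distrib add_divide_distrib distrib_right)
  also have "(\<Sum>p\<in>P. \<Sum>r\<in>P. (norm (a r))\<^sup>2 / 2 * (norm (G (\<theta> p - \<theta> r)))\<^sup>2)
           = (\<Sum>p\<in>P. \<Sum>r\<in>P. (norm (a p))\<^sup>2 / 2 * (norm (G (\<theta> r - \<theta> p)))\<^sup>2)"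
    by (rule sum.swap)
  also have "(\<Sum>p\<in>P. \<Sum>r\<in>P. (norm (a p))\<^sup>2 / 2 * (norm (G (\<theta> p - \<theta> r)))\<^sup>2)
           = (\<Sum>p\<in>P. \<Sum>r\<in>P. (norm (a p))\<^sup>2 / 2 * (norm (G (\<theta> r - \<theta> p)))\<^sup>2)"
  proof -
    have "G (- \<beta>) = cnj (G \<beta>)" for \<beta> by (simp add: G_def cnj_e1)
    then have "norm (G (\<theta> p - \<theta> r)) = norm (G (\<theta> r - \<theta> p))" for p r
      by (metis complex_mod_cnj minus_diff_eq)
    then show ?thesis by simp
  qed
  also have "(\<Sum>p\<in>P. \<Sum>r\<in>P. (norm (a p))\<^sup>2 / 2 * (norm (G (\<theta> r - \<theta> p)))\<^sup>2)
     + (\<Sum>p\<in>P. \<Sum>r\<in>P. (norm (a p))\<^sup>2 / 2 * (norm (G (\<theta> r - \<theta> p)))\<^sup>2)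
     = (\<Sum>p\<in>P. (norm (a p))\<^sup>2 * (\<Sum>r\<in>P. (norm (G (\<theta> r - \<theta> p)))\<^sup>2))"
    by (simp flip: sum.distrib add: sum_distrib_left)
  also have "\<dots> \<le> (\<Sum>p\<in>P. (norm (a p))\<^sup>2 * (5 * (real Q)\<^sup>2))"
    by (intro sum_mono mult_left_mono row) auto
  also have "\<dots> = 5 * (real Q)\<^sup>2 * M"
    by (simp add: M_def sum_distrib_left mult_ac)
  finally have upper: "(\<Sum>j<2 * Q. \<Sum>i<2 * Q. (norm (S (y + real i - real j)))\<^sup>2) \<le> 5 * (real Q)\<^sup>2 * M" .

  \<comment> \<open>For each \<open>j < Q\<close> the substitution \<open>i = n + j\<close> keeps
    \<open>i < 2 * Q\<close>, so the wanted sum occurs in full for \<open>Q\<close> values of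
    \<open>j\<close>.\<close>
  have "real Q * (\<Sum>n<Q. (norm (S (y + real n)))\<^sup>2) = (\<Sum>j<Q. \<Sum>n<Q. (norm (S (y + real n)))\<^sup>2)"
    by simp
  also have "\<dots> \<le> (\<Sum>j<Q. \<Sum>i<2 * Q. (norm (S (y + real i - real j)))\<^sup>2)"
  proof (rule sum_mono)
    fix j assume "j \<in> {..<Q}"
    then have "(\<lambda>n. n + j) ` {..<Q} \<subseteq> {..<2 * Q}" by auto
    then have "(\<Sum>i\<in>(\<lambda>n. n + j) ` {..<Q}. (norm (S (y + real i - real j)))\<^sup>2)
             \<le> (\<Sum>i<2 * Q. (norm (S (y + real i - real j)))\<^sup>2)"
      by (intro sum_mono2) auto
    moreover have "(\<Sum>i\<in>(\<lambda>n. n + j) ` {..<Q}. (norm (S (y + real i - real j)))\<^sup>2)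
                 = (\<Sum>n<Q. (norm (S (y + real n)))\<^sup>2)"
      by (subst sum.reindex) (auto simp: inj_on_def add_diff_eq[symmetric])
    ultimately show "(\<Sum>n<Q. (norm (S (y + real n)))\<^sup>2)
             \<le> (\<Sum>i<2 * Q. (norm (S (y + real i - real j)))\<^sup>2)" by simp
  qed
  also have "\<dots> \<le> (\<Sum>j<2 * Q. \<Sum>i<2 * Q. (norm (S (y + real i - real j)))\<^sup>2)"
    by (intro sum_mono2 sum_nonneg) auto
  also note upper
  finally have "(\<Sum>n<Q. (norm (S (y + real n)))\<^sup>2) \<le> 5 * real Q * M"
    using Q0 by (simp add: power2_eq_square)
  then show ?thesis by (simp add: S_def M_def)
qed

section \<open>Mean squares of sawtooth sums\<close>

text \<open>For \<open>d > 0\<close> this is the mean-zero sawtooth (d - 1)/(2d) - (N mod d)/d, by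
  \<open>div_eq_saw\<close>. The phase contains \<open>Suc N\<close> because the increment of the
  Fourier sum from \<open>m\<close> to \<open>m + 1\<close> detects whether \<open>d\<close> divides
  \<open>m\<close>.\<close>

definition saw :: "nat \<Rightarrow> nat \<Rightarrow> complex" where
  "saw d N = (\<Sum>h=1..<d. e1 (real h * real (Suc N) / real d) / (e1 (real h / real d) - 1)) / of_nat d"

text \<open>Orthogonality of additive characters: off the multiples of \<open>d\<close> this is a
  geometric sum whose ratio is a nontrivial d-th root of unity.\<close>

lemma sum_e1_multiples:
  assumes "d > 0"
  shows "(\<Sum>h<d. e1 (real h * (real m / real d))) = (if d dvd m then of_nat d else 0)"
proof (cases "d dvd m")
  case True
  then obtain k where "m = d * k" by blast
  then have "e1 (real h * (real m / real d)) = 1" for h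
    using assms e1_of_nat[of "h * k"] by simp
  then show ?thesis using True by simp
next
  case False
  have "frac (real m / real d) \<noteq> 0"
  proof
    assume "frac (real m / real d) = 0"
    then obtain k where "real m / real d = of_int k" by (auto simp: frac_eq_0_iff elim: Ints_cases)
    then have "real_of_int (int m) = real_of_int (int d * k)" using assms by (simp add: field_simps)
    then have "int m = int d * k" by linarith
    then have "int d dvd int m" by simp
    with False show False by simp
  qed
  then have "0 < frac (real m / real d)" using frac_ge_0[of "real m / real d"] by linarith
  then have "e1 (real m / real d) \<noteq> 1"
    using e1_minus_1_nonzero[OF _ frac_lt_1] by (simp add: e1_frac)
  moreover have "e1 (real m / real d) ^ d = 1"
    using assms by (simp add: e1_power)
  ultimately show ?thesis
    using False by (simp flip: e1_power add: sum_gp_strict del: times_divide_eq_right)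
qed

text \<open>The terms \<open>h\<close> and \<open>d - h\<close> pair up: their values of
  \<open>e1\<close> are inverse to each other, and 1/(z - 1) + 1/(1/z - 1) = -1.\<close>

lemma sum_inverse_e1_minus_1:
  assumes "d > 0"
  shows "(\<Sum>h=1..<d. 1 / (e1 (real h / real d) - 1)) = - (of_nat d - 1) / 2"
proof -
  let ?g = "\<lambda>h. 1 / (e1 (real h / real d) - 1)"
  have "?g h + ?g (d - h) = -1" if h: "h \<in> {1..<d}" for h
  proof -
    have ne: "e1 (real h / real d) \<noteq> 1" using h by (intro e1_minus_1_nonzero) auto
    have "e1 (real (d - h) / real d) * e1 (real h / real d) = 1"
      using h assms e1_of_nat[of 1] by (simp flip: e1_add add_divide_distrib add: of_nat_diff)
    then have inv: "e1 (real (d - h) / real d) = 1 / e1 (real h / real d)"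
      by (metis mult_eq_0_iff nonzero_eq_divide_eq zero_neq_one)
    have "e1 (real h / real d) \<noteq> 0" by (simp add: e1_def)
    then show ?thesis unfolding inv using ne by (simp add: divide_simps) (simp add: algebra_simps)
  qed
  then have "(\<Sum>h=1..<d. ?g h + ?g (d - h)) = (\<Sum>h=1..<d. -1)" by (intro sum.cong refl)
  moreover have "(\<Sum>h=1..<d. ?g (d - h)) = (\<Sum>h=1..<d. ?g h)"
    by (rule sum.reindex_bij_witness[of _ "\<lambda>h. d - h" "\<lambda>h. d - h"]) auto
  ultimately have "2 * (\<Sum>h=1..<d. ?g h) = - of_nat (d - 1)"
    by (simp add: sum.distrib)
  then show ?thesis using assms by (simp add: of_nat_diff field_simps)
qed

text \<open>Induction on \<open>N\<close>. The difference \<open>G (Suc m) - G m\<close> cancels the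
  denominators and leaves a full character sum without its term \<open>h = 0\<close>; the starting
  value is \<open>sum_inverse_e1_minus_1\<close>.\<close>

lemma div_eq_saw:
  assumes d: "d > 0"
  shows "of_nat (N div d) = of_nat N / of_nat d + saw d N - 1 / 2 + 1 / (2 * of_nat d)"
proof -
  define G where "G m = (\<Sum>h=1..<d. e1 (real h * real m / real d) / (e1 (real h / real d) - 1))" for m
  have step: "G (Suc m) = G m + (if d dvd m then of_nat d else 0) - 1" for m
  proof -
    have "G (Suc m) - G m = (\<Sum>h=1..<d. e1 (real h * (real m / real d)))"
      unfolding G_def sum_subtractf[symmetric]
    proof (rule sum.cong[OF refl])
      fix h assume h: "h \<in> {1..<d}"
      have "e1 (real h / real d) \<noteq> 1" using h by (intro e1_minus_1_nonzero) auto
      moreover have "e1 (real h * real (Suc m) / real d) = e1 (real h * real m / real d) * e1 (real h / real d)"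
        by (simp flip: e1_add add: add_divide_distrib distrib_left add.commute)
      ultimately show "e1 (real h * real (Suc m) / real d) / (e1 (real h / real d) - 1) -
             e1 (real h * real m / real d) / (e1 (real h / real d) - 1) = e1 (real h * (real m / real d))"
        by (simp add: divide_simps) (simp add: algebra_simps)
    qed
    also have "\<dots> = (\<Sum>h<d. e1 (real h * (real m / real d))) - 1"
    proof -
      have "{..<d} = insert 0 {1..<d}" using d by auto
      then show ?thesis using e1_of_nat[of 0] by simp
    qed
    finally show ?thesis using sum_e1_multiples[OF d, of m] by (simp add: algebra_simps)
  qed
  have "G 0 = - (of_nat d - 1) / 2"
    using sum_inverse_e1_minus_1[OF d] e1_of_nat[of 0] by (simp add: G_def)
  then have G: "G (Suc N) = of_nat d * of_nat (N div d) - of_nat N + (of_nat d - 1) / 2"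
  proof (induction N)
    case 0
    then show ?case by (simp add: step field_simps)
  next
    case (Suc N)
    then show ?case
      by (simp add: step[of "Suc N"] div_Suc dvd_eq_mod_eq_0) (simp add: algebra_simps)
  qed
  have "saw d N = G (Suc N) / of_nat d" by (simp add: saw_def G_def)
  then show ?thesis unfolding G using d by (simp add: field_simps)
qed

text \<open>The fraction 0 is left out because \<open>saw\<close> has no constant frequency.\<close>

definition farey :: "nat \<Rightarrow> (nat \<times> nat) set" where
  "farey D = {(q, a). 1 \<le> q \<and> q \<le> D \<and> 1 \<le> a \<and> a < q \<and> coprime a q}"

lemma finite_farey [simp]: "finite (farey D)"
  by (rule finite_subset[of _ "{1..D} \<times> {1..D}"]) (auto simp: farey_def)

text \<open>Over the common denominator \<open>q * s\<close>, at most D^2, the numerator is an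
  integer \<open>m\<close>. It cannot vanish, since reduced fractions in (0, 1) that agree modulo 1
  coincide.\<close>

lemma farey_spacing:
  fixes k :: int
  assumes "(q, a) \<in> farey D" "(s, b) \<in> farey D" "(q, a) \<noteq> (s, b)"
  shows "1 / (real D)\<^sup>2 \<le> \<bar>real a / real q - real b / real s - of_int k\<bar>"
proof -
  define m where "m = int a * int s - int q * (int b + k * int s)"
  have pos: "0 < q" "0 < s" "q \<le> D" "s \<le> D" "a < q" "b < s"
    and cop: "coprime a q" "coprime b s"
    using assms by (auto simp: farey_def)
  have eq: "real a / real q - real b / real s - of_int k = of_int m / (real q * real s)"
    using pos by (simp add: m_def field_simps)
  have "m \<noteq> 0"
  proof
    assume "m = 0"
    then have *: "int a * int s = int q * (int b + k * int s)" by (simp add: m_def)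
    then have "int q dvd int a * int s" by simp
    then have "q dvd s" using cop(1)
      by (metis coprime_dvd_mult_right_iff coprime_int_iff coprime_commute int_dvd_int_iff)
    moreover have "int s dvd int q * int b"
    proof -
      have "int q * int b = int s * (int a - int q * k)" using * by (simp add: algebra_simps)
      then show ?thesis by simp
    qed
    then have "s dvd q" using cop(2)
      by (metis coprime_dvd_mult_left_iff coprime_int_iff coprime_commute int_dvd_int_iff)
    ultimately have qs: "q = s" by (simp add: dvd_antisym)
    with * pos have "int a = int b + k * int q" by simp
    \<comment> \<open>Both \<open>a\<close> and \<open>b\<close> lie in [1, q), so they differ by
      less than \<open>q\<close>.\<close>
    with pos qs have "k = 0"
      by (smt (verit, best) mult_less_cancel_right mult_minus_left of_nat_0_le_iff of_nat_less_iff
          mult_le_cancel_right1 zmult_zless_mono2 mult_cancel_right1)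
    with \<open>int a = int b + k * int q\<close> qs assms(3) show False by simp
  qed
  then have m1: "1 \<le> \<bar>real_of_int m\<bar>" by linarith
  have "real q * real s \<le> (real D)\<^sup>2" using pos by (simp add: power2_eq_square mult_mono)
  then have "1 / (real D)\<^sup>2 \<le> 1 / (real q * real s)"
    using pos by (intro divide_left_mono) auto
  also have "\<dots> \<le> \<bar>real_of_int m\<bar> / (real q * real s)"
    using m1 by (intro divide_right_mono) auto
  also have "\<dots> = \<bar>real a / real q - real b / real s - of_int k\<bar>"
    unfolding eq by simp
  finally show ?thesis .
qed

text \<open>The chord bound cancels the factor \<open>q\<close>, leaving reciprocal squares of
  \<open>a\<close> and \<open>q - a\<close>. With coprimality dropped, each denominator contributes
  at most (2 + 2)/16.\<close>

lemma sum_inverse_norm_farey: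
  "(\<Sum>(q, a)\<in>farey D. 1 / (real q * norm (e1 (real a / real q) - 1))\<^sup>2) \<le> real D / 4"
proof -
  have "(\<Sum>(q, a)\<in>farey D. 1 / (real q * norm (e1 (real a / real q) - 1))\<^sup>2)
      \<le> (\<Sum>(q, a)\<in>farey D. (1 / (real a)\<^sup>2 + 1 / (real (q - a))\<^sup>2) / 16)"
  proof (rule sum_mono, clarify)
    fix q a assume "(q, a) \<in> farey D"
    then have qa: "0 < q" "0 < a" "a < q" by (auto simp: farey_def)
    define t where "t = real a / real q"
    have t: "0 < t" "t < 1" "1 - t = real (q - a) / real q"
      using qa by (auto simp: t_def of_nat_diff field_simps)
    have "1 / (real q * norm (e1 t - 1))\<^sup>2 = 1 / (norm (e1 t - 1))\<^sup>2 / (real q)\<^sup>2"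
      by (simp add: power_mult_distrib)
    also have "\<dots> \<le> (1 / t\<^sup>2 + 1 / (1 - t)\<^sup>2) / 16 / (real q)\<^sup>2"
      using t by (intro divide_right_mono inverse_norm_e1_minus_1) auto
    also have "\<dots> = (1 / (real a)\<^sup>2 + 1 / (real (q - a))\<^sup>2) / 16"
      unfolding t(3) using qa by (simp add: t_def power_divide field_simps)
    finally show "1 / (real q * norm (e1 (real a / real q) - 1))\<^sup>2
        \<le> (1 / (real a)\<^sup>2 + 1 / (real (q - a))\<^sup>2) / 16" by (simp add: t_def)
  qed
  also have "\<dots> \<le> (\<Sum>(q, a)\<in>(SIGMA q:{1..D}. {1..<q}). (1 / (real a)\<^sup>2 + 1 / (real (q - a))\<^sup>2) / 16)"
    by (intro sum_mono2) (auto simp: farey_def)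
  also have "\<dots> = (\<Sum>q=1..D. \<Sum>a=1..<q. (1 / (real a)\<^sup>2 + 1 / (real (q - a))\<^sup>2) / 16)"
    by (subst sum.Sigma) auto
  also have "\<dots> \<le> (\<Sum>q=1..D. 1 / 4)"
  proof (rule sum_mono)
    fix q :: nat assume "q \<in> {1..D}"
    have "(\<Sum>a=1..<q. 1 / (real a)\<^sup>2) \<le> (\<Sum>a=1..q. 1 / (real a)\<^sup>2)"
      by (intro sum_mono2) auto
    also have "\<dots> \<le> 2" by (rule sum_inverse_squares_le)
    finally have 1: "(\<Sum>a=1..<q. 1 / (real a)\<^sup>2) \<le> 2" .
    moreover have "(\<Sum>a=1..<q. 1 / (real (q - a))\<^sup>2) = (\<Sum>a=1..<q. 1 / (real a)\<^sup>2)"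
      by (rule sum.reindex_bij_witness[of _ "\<lambda>h. q - h" "\<lambda>h. q - h"]) auto
    ultimately show "(\<Sum>a=1..<q. (1 / (real a)\<^sup>2 + 1 / (real (q - a))\<^sup>2) / 16) \<le> 1 / 4"
      by (simp add: sum.distrib flip: sum_divide_distrib)
  qed
  finally show ?thesis by simp
qed

text \<open>Here \<open>k\<close> is the gcd of \<open>d\<close> and \<open>h\<close>, so h/d = a/q.
  The constraint \<open>k * q \<le> D\<close> sits in the summand so that every \<open>k\<close>
  shares the index set \<open>farey D\<close>, and with it the same spaced frequencies.\<close>

lemma sum_by_reduced_fractions:
  fixes X :: "nat \<Rightarrow> nat \<Rightarrow> complex"
  shows "(\<Sum>d=1..D. \<Sum>h=1..<d. X d h)
       = (\<Sum>k=1..D. \<Sum>(q, a)\<in>farey D. if k * q \<le> D then X (k * q) (k * a) else 0)"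
proof -
  have "(\<Sum>d=1..D. \<Sum>h=1..<d. X d h) = (\<Sum>(d, h)\<in>(SIGMA d:{1..D}. {1..<d}). X d h)"
    by (subst sum.Sigma) auto
  also have "\<dots> = (\<Sum>(k, q, a)\<in>{x \<in> {1..D} \<times> farey D. fst x * fst (snd x) \<le> D}. X (k * q) (k * a))"
  proof (rule sum.reindex_bij_witness[of _ "\<lambda>(k, q, a). (k * q, k * a)"
          "\<lambda>(d, h). (gcd d h, d div gcd d h, h div gcd d h)"], goal_cases)
    case (2 x)
    then obtain d h where x: "x = (d, h)" "1 \<le> d" "d \<le> D" "1 \<le> h" "h < d" by auto
    define g where "g = gcd d h"
    have g: "g dvd d" "g dvd h" "g > 0" using x by (auto simp: g_def)
    then obtain q a where qa: "d = g * q" "h = g * a" by (auto elim!: dvdE)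
    have "gcd d h = g" by (simp add: g_def)
    then have gcd: "gcd (g * q) (g * a) = g" unfolding qa .
    then have "g * gcd q a = g" by (simp add: gcd_mult_distrib_nat)
    then have "coprime a q" using g(3) by (simp add: coprime_iff_gcd_eq_1 gcd.commute)
    moreover have "1 \<le> q" "1 \<le> a" "a < q" "g * q \<le> D" using x qa by auto
    moreover from this have "q \<le> D" "g \<le> D"
      using g(3) by (auto intro: order_trans[rotated])
    ultimately show ?case using g(3) by (simp add: x(1) qa gcd farey_def Suc_le_eq)
  next
    case (3 x)
    then obtain k q a where x: "x = (k, q, a)" "1 \<le> k" "k * q \<le> D" "1 \<le> q" "1 \<le> a" "a < q"
      and cop: "coprime a q" by (auto simp: farey_def)
    have "gcd (k * q) (k * a) = k"
      using cop by (simp add: gcd_mult_distrib_nat[symmetric] coprime_iff_gcd_eq_1 gcd.commute)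
    then show ?case using x by auto
  qed (auto simp: farey_def)
  also have "\<dots> = (\<Sum>(k, q, a)\<in>{1..D} \<times> farey D. if k * q \<le> D then X (k * q) (k * a) else 0)"
    by (subst sum.inter_filter) (auto intro!: sum.cong)
  also have "\<dots> = (\<Sum>k=1..D. \<Sum>(q, a)\<in>farey D. if k * q \<le> D then X (k * q) (k * a) else 0)"
    by (subst sum.cartesian_product[symmetric]) (simp add: case_prod_unfold)
  finally show ?thesis .
qed

text \<open>Cauchy-Schwarz with each weight split into two square roots, one for each
  factor.\<close>

lemma norm_weighted_sum_squared_le:
  fixes z :: "'a \<Rightarrow> 'b::real_normed_vector"
  assumes "finite A" "\<And>k. k \<in> A \<Longrightarrow> w k \<ge> (0::real)"
  shows "(norm (\<Sum>k\<in>A. w k *\<^sub>R z k))\<^sup>2 \<le> (\<Sum>k\<in>A. w k) * (\<Sum>k\<in>A. w k * (norm (z k))\<^sup>2)"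
proof -
  have "norm (\<Sum>k\<in>A. w k *\<^sub>R z k) \<le> (\<Sum>k\<in>A. sqrt (w k) * (sqrt (w k) * norm (z k)))"
    using assms by (intro sum_norm_le) (simp flip: mult.assoc)
  then have "(norm (\<Sum>k\<in>A. w k *\<^sub>R z k))\<^sup>2 \<le> (\<Sum>k\<in>A. sqrt (w k) * (sqrt (w k) * norm (z k)))\<^sup>2"
    by (intro power_mono) auto
  also have "\<dots> \<le> (\<Sum>k\<in>A. (sqrt (w k))\<^sup>2) * (\<Sum>k\<in>A. (sqrt (w k) * norm (z k))\<^sup>2)"
    by (rule Cauchy_Schwarz_ineq_sum)
  also have "\<dots> = (\<Sum>k\<in>A. w k) * (\<Sum>k\<in>A. w k * (norm (z k))\<^sup>2)"
    using assms by (simp add: power_mult_distrib)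
  finally show ?thesis .
qed

text \<open>
  The pairs \<open>(d, h)\<close> with \<open>gcd d h = k\<close> form one sum \<open>F k\<close> over Farey fractions. Cauchy-Schwarz with
  weights \<open>1/k\<close> recombines these sums at the cost of one factor \<open>harm D\<close>.
\<close>

lemma mean_square_saw:
  assumes D: "D \<ge> 1" and Q: "D\<^sup>2 \<le> Q" and c: "\<And>d. d \<in> {1..D} \<Longrightarrow> norm (c d) \<le> B"
  shows "(\<Sum>n<Q. (norm (\<Sum>d=1..D. c d * saw d (y + n)))\<^sup>2)
           \<le> 5 / 4 * real Q * real D * (B * harm D)\<^sup>2"
proof -
  \<comment> \<open>The factor 1/k of 1/(k * q) stays outside \<alpha>, to serve as the
    Cauchy-Schwarz weight.\<close>
  define \<alpha> where "\<alpha> k = (\<lambda>(q, a). (if k * q \<le> D then c (k * q) else 0) /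
                      (of_nat q * (e1 (real a / real q) - 1)))" for k
  define F where "F k n = (\<Sum>p\<in>farey D. \<alpha> k p * e1 ((case p of (q, a) \<Rightarrow> real a / real q) *
                      (real (Suc y) + real n)))" for k n
  have B: "B \<ge> 0" using order_trans[OF norm_ge_zero c[of 1]] D by simp

  have split: "(\<Sum>d=1..D. c d * saw d (y + n)) = (\<Sum>k=1..D. (1 / real k) *\<^sub>R F k n)" for n
  proof -
    have "(\<Sum>d=1..D. c d * saw d (y + n)) = (\<Sum>d=1..D. \<Sum>h=1..<d.
        c d * e1 (real h / real d * real (Suc (y + n))) / (of_nat d * (e1 (real h / real d) - 1)))"
      by (simp add: saw_def sum_distrib_left sum_divide_distrib mult.commute)
    also have "\<dots> = (\<Sum>k=1..D. \<Sum>(q, a)\<in>farey D. if k * q \<le> D then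
        c (k * q) * e1 (real (k * a) / real (k * q) * real (Suc (y + n))) /
        (of_nat (k * q) * (e1 (real (k * a) / real (k * q)) - 1)) else 0)"
      by (rule sum_by_reduced_fractions)
    also have "\<dots> = (\<Sum>k=1..D. (1 / real k) *\<^sub>R F k n)"
      unfolding F_def scaleR_sum_right
      by (intro sum.cong refl)
         (auto simp: \<alpha>_def scaleR_conv_of_real add.assoc)
    finally show ?thesis .
  qed

  \<comment> \<open>The bound is uniform in \<open>k\<close>. The assumption \<open>Q\<close> is the
    length condition of the sieve for spacing 1/D^2.\<close>
  have F: "(\<Sum>n<Q. (norm (F k n))\<^sup>2) \<le> 5 / 4 * real Q * real D * B\<^sup>2" if k: "k \<ge> 1" for k
  proof -
    have sieve: "(\<Sum>n<Q. (norm (F k n))\<^sup>2) \<le> 5 * real Q * (\<Sum>p\<in>farey D. (norm (\<alpha> k p))\<^sup>2)"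
      unfolding F_def
    proof (rule large_sieve_dual[where \<delta> = "1 / (real D)\<^sup>2"])
      show "1 / (1 / (real D)\<^sup>2) \<le> real Q" using Q by (simp flip: of_nat_power)
      show "1 / (real D)\<^sup>2 \<le> \<bar>(case p of (q, a) \<Rightarrow> real a / real q) -
          (case r of (q, a) \<Rightarrow> real a / real q) - of_int k\<bar>"
        if "p \<in> farey D" "r \<in> farey D" "p \<noteq> r" for p r k
        using that farey_spacing[of "fst p" "snd p" D "fst r" "snd r" k]
        by (simp add: case_prod_beta prod_eq_iff)
    qed (use D in auto)
    have "(\<Sum>p\<in>farey D. (norm (\<alpha> k p))\<^sup>2)
        \<le> (\<Sum>(q, a)\<in>farey D. B\<^sup>2 * (1 / (real q * norm (e1 (real a / real q) - 1))\<^sup>2))"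
    proof (rule sum_mono, clarify)
      fix q a assume qa: "(q, a) \<in> farey D"
      have "norm (if k * q \<le> D then c (k * q) else 0) \<le> B"
        using c[of "k * q"] B qa k by (auto simp: farey_def)
      then have "(norm (if k * q \<le> D then c (k * q) else 0))\<^sup>2 \<le> B\<^sup>2"
        by (intro power_mono) auto
      then have "(norm (if k * q \<le> D then c (k * q) else 0))\<^sup>2 / (real q * norm (e1 (real a / real q) - 1))\<^sup>2
         \<le> B\<^sup>2 / (real q * norm (e1 (real a / real q) - 1))\<^sup>2"
        by (intro divide_right_mono) auto
      then show "(norm (\<alpha> k (q, a)))\<^sup>2 \<le> B\<^sup>2 * (1 / (real q * norm (e1 (real a / real q) - 1))\<^sup>2)"
        by (simp add: \<alpha>_def norm_divide norm_mult power_divide)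
    qed
    also have "\<dots> = B\<^sup>2 * (\<Sum>(q, a)\<in>farey D. 1 / (real q * norm (e1 (real a / real q) - 1))\<^sup>2)"
      by (simp add: sum_distrib_left case_prod_unfold)
    also have "\<dots> \<le> B\<^sup>2 * (real D / 4)"
      by (intro mult_left_mono sum_inverse_norm_farey) auto
    finally have "5 * real Q * (\<Sum>p\<in>farey D. (norm (\<alpha> k p))\<^sup>2) \<le> 5 * real Q * (B\<^sup>2 * (real D / 4))"
      by (intro mult_left_mono) auto
    with sieve show ?thesis by (simp add: mult_ac)
  qed

  have harm: "(\<Sum>k=1..D. 1 / real k) = harm D"
    by (simp add: harm_def inverse_eq_divide)
  have "(\<Sum>n<Q. (norm (\<Sum>d=1..D. c d * saw d (y + n)))\<^sup>2)
      \<le> (\<Sum>n<Q. (\<Sum>k=1..D. 1 / real k) * (\<Sum>k=1..D. 1 / real k * (norm (F k n))\<^sup>2))"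
    unfolding split by (intro sum_mono norm_weighted_sum_squared_le) auto
  also have "\<dots> = harm D * (\<Sum>k=1..D. 1 / real k * (\<Sum>n<Q. (norm (F k n))\<^sup>2))"
    by (simp only: harm sum_distrib_left sum.swap[of _ "{..<Q}"])
  also have "\<dots> \<le> harm D * (\<Sum>k=1..D. 1 / real k * (5 / 4 * real Q * real D * B\<^sup>2))"
    by (intro mult_left_mono sum_mono F harm_nonneg) auto
  also have "\<dots> = harm D * ((\<Sum>k=1..D. 1 / real k) * (5 / 4 * real Q * real D * B\<^sup>2))"
    by (simp only: sum_distrib_right)
  also have "\<dots> = 5 / 4 * real Q * real D * (B * harm D)\<^sup>2"
    unfolding harm by (simp add: power2_eq_square)
  finally show ?thesis .
qed

section \<open>The error term at integers\<close>

text \<open>The induction step moves out the block N/(D + 2) < n \<le> N/(D + 1), on which the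
  quotient is constantly D + 1.\<close>

lemma sum_div_hyperbola:
  fixes f :: "nat \<Rightarrow> complex"
  shows "(\<Sum>n=1..N. f (N div n)) = (\<Sum>n=1..N div Suc D. f (N div n))
           + (\<Sum>d=1..D. f d * (of_nat (N div d) - of_nat (N div Suc d)))"
proof (induction D)
  case (Suc D)
  have le: "N div Suc (Suc D) \<le> N div Suc D" by (intro div_le_mono2) auto
  have "(\<Sum>n=1..N div Suc D. f (N div n))
      = (\<Sum>n=1..N div Suc (Suc D). f (N div n)) + (\<Sum>n\<in>{N div Suc (Suc D)<..N div Suc D}. f (N div n))"
    using le by (subst sum.union_disjoint[symmetric]) (auto intro!: sum.cong)
  also have "(\<Sum>n\<in>{N div Suc (Suc D)<..N div Suc D}. f (N div n))
           = (\<Sum>n\<in>{N div Suc (Suc D)<..N div Suc D}. f (Suc D))"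
  proof (rule sum.cong[OF refl])
    fix n assume "n \<in> {N div Suc (Suc D)<..N div Suc D}"
    then have n: "n > 0" "N < n * Suc (Suc D)" "n * Suc D \<le> N"
      by (auto simp: div_less_iff_less_mult less_eq_div_iff_mult_less_eq)
    then have "N div n = Suc D"
      by (intro div_nat_eqI) (auto simp: mult.commute)
    then show "f (N div n) = f (Suc D)" by simp
  qed
  finally show ?case using Suc le by (simp add: of_nat_diff algebra_simps)
qed simp

text \<open>Nested integer parts: [x/n] = [[x]/n]. This is what reduces the mean square to integer
  arguments.\<close>

lemma S_sum_eq:
  assumes "x \<ge> 0"
  shows "S_sum f x = (\<Sum>n=1..nat \<lfloor>x\<rfloor>. f (nat \<lfloor>x\<rfloor> div n))"
  unfolding S_sum_def
proof (rule sum.cong)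
  show "{n. 1 \<le> n \<and> real n \<le> x} = {1..nat \<lfloor>x\<rfloor>}"
    using assms by (auto simp: le_nat_floor) linarith
  show "f (nat \<lfloor>x / real n\<rfloor>) = f (nat \<lfloor>x\<rfloor> div n)" for n
    using floor_divide_real_eq_div[of "int n" x] assms by (simp add: nat_div_distrib)
qed

text \<open>Bernoulli's inequality for (1 + 1/x)^\<eta>, obtained from Young's inequality, controls
  the increment of x^\<eta>. The factor 2 comes from 1 - \<eta> \<ge> 1/2. The telescoping right
  side makes tails of the series \<open>C_const\<close> summable at sight.\<close>

lemma powr_telescope:
  assumes \<eta>: "0 < \<eta>" "\<eta> \<le> 1 / 2" and n: "n \<ge> 1"
  shows "real n powr \<eta> / (real n * (real n + 1)) \<le> 2 * (real n powr (\<eta> - 1) - (real n + 1) powr (\<eta> - 1))"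
proof -
  define x where "x = real n"
  have x: "x \<ge> 1" using n by (simp add: x_def)
  have "(x + 1) powr \<eta> = x powr \<eta> * (1 + 1 / x) powr \<eta>"
    using x by (simp flip: powr_mult add: distrib_left)
  also have "(1 + 1 / x) powr \<eta> \<le> 1 + \<eta> / x"
  proof -
    have "(1 + 1 / x) powr \<eta> * 1 powr (1 - \<eta>) \<le> \<eta> * (1 + 1 / x) + (1 - \<eta>) * 1"
      using \<eta> x by (intro Youngs_inequality_0) (auto intro: add_pos_pos)
    then show ?thesis by (simp add: algebra_simps)
  qed
  finally have "(x + 1) powr \<eta> \<le> x powr \<eta> * (1 + \<eta> / x)" using x by simp
  then have "x * (x + 1) powr \<eta> \<le> x powr \<eta> * (x + \<eta>)"
    using x by (simp add: field_simps)
  also have "\<dots> \<le> x powr \<eta> * (x + 1 / 2)" using \<eta> by (intro mult_left_mono) auto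
  finally have "x powr \<eta> \<le> 2 * ((x + 1) * x powr \<eta> - x * (x + 1) powr \<eta>)"
    by (simp add: algebra_simps)
  then have "x powr \<eta> / (x * (x + 1)) \<le> 2 * ((x + 1) * x powr \<eta> - x * (x + 1) powr \<eta>) / (x * (x + 1))"
    using x by (intro divide_right_mono) auto
  also have "\<dots> = 2 * (x powr \<eta> / x - (x + 1) powr \<eta> / (x + 1))"
    using x by (simp add: field_simps)
  also have "\<dots> = 2 * (x powr (\<eta> - 1) - (x + 1) powr (\<eta> - 1))"
    using x by (simp add: powr_diff)
  finally show ?thesis by (simp add: x_def)
qed

text \<open>The norm of each term is at most \<open>u m - u (Suc m)\<close> with \<open>u\<close>
  tending to 0. Hence \<open>u 0\<close> bounds every partial sum and \<open>u D\<close> bounds the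
  tail.\<close>

lemma C_const_tail:
  assumes \<eta>: "0 < \<eta>" "\<eta> \<le> 1 / 2" and K: "\<And>n. n \<ge> 1 \<Longrightarrow> norm (f n) \<le> K * real n powr \<eta>"
  shows "(\<Sum>d=1..D. norm (f d / (of_nat d * of_nat (Suc d)))) \<le> 2 * K"
    and "norm (C_const f - (\<Sum>d=1..D. f d / (of_nat d * of_nat (Suc d))))
           \<le> 2 * K * real (Suc D) powr (\<eta> - 1)"
proof -
  define u where "u m = 2 * K * real (Suc m) powr (\<eta> - 1)" for m
  define t where "t m = f (m + 1) / (of_nat (m + 1) * of_nat (m + 2))" for m
  have K0: "K \<ge> 0" using order_trans[OF norm_ge_zero K[of 1]] by simp
  have tu: "norm (t m) \<le> u m - u (Suc m)" for m
  proof -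
    have "norm (t m) = norm (f (Suc m)) / (real (Suc m) * (real (Suc m) + 1))"
      unfolding t_def norm_divide norm_mult norm_of_nat by (simp add: add_ac)
    also have "\<dots> \<le> K * real (Suc m) powr \<eta> / (real (Suc m) * (real (Suc m) + 1))"
      by (intro divide_right_mono K) auto
    also have "\<dots> = K * (real (Suc m) powr \<eta> / (real (Suc m) * (real (Suc m) + 1)))" by simp
    also have "\<dots> \<le> K * (2 * (real (Suc m) powr (\<eta> - 1) - (real (Suc m) + 1) powr (\<eta> - 1)))"
      using K0 \<eta> by (intro mult_left_mono powr_telescope) auto
    also have "\<dots> = u m - u (Suc m)" by (simp add: u_def algebra_simps)
    finally show ?thesis .
  qed
  have "(\<lambda>m. real (Suc m) powr (\<eta> - 1)) \<longlonglongrightarrow> 0"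
    using \<eta> by (intro tendsto_neg_powr filterlim_compose[OF filterlim_real_sequentially filterlim_Suc]) auto
  then have u0: "u \<longlonglongrightarrow> 0" unfolding u_def by (intro tendsto_mult_right_zero)
  have sums: "(\<lambda>m. u (m + k) - u (Suc (m + k))) sums u k" for k
    using telescope_sums'[of "\<lambda>m. u (m + k)" 0] u0 LIMSEQ_ignore_initial_segment[of u 0 k] by simp
  have t: "summable (\<lambda>m. norm (t (m + k)))" "(\<Sum>m. norm (t (m + k))) \<le> u k" for k
  proof -
    show 1: "summable (\<lambda>m. norm (t (m + k)))"
      using sums[of k] by (intro summable_comparison_test'[OF sums_summable[OF sums[of k]]]) (auto intro: tu)
    show "(\<Sum>m. norm (t (m + k))) \<le> u k"
      using suminf_le[OF tu[of "_ + k"] 1 sums_summable[OF sums[of k]]] sums_unique[OF sums[of k]] by simp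
  qed
  have shift: "(\<Sum>d=1..D. g d) = (\<Sum>m<D. g (Suc m))" for g :: "nat \<Rightarrow> 'b::comm_monoid_add"
    by (rule sum.reindex_bij_witness[of _ Suc "\<lambda>d. d - 1"]) auto
  have "(\<Sum>d=1..D. norm (f d / (of_nat d * of_nat (Suc d)))) = (\<Sum>m<D. norm (t m))"
    unfolding shift by (simp add: t_def)
  also have "\<dots> \<le> u 0"
    using sum_le_suminf[of "\<lambda>m. norm (t m)" "{..<D}"] t[of 0] by simp
  finally show "(\<Sum>d=1..D. norm (f d / (of_nat d * of_nat (Suc d)))) \<le> 2 * K"
    by (simp add: u_def)
  have "C_const f = suminf t" unfolding C_const_def t_def ..
  also have "\<dots> = (\<Sum>m. t (m + D)) + (\<Sum>m<D. t m)"
    using t(1)[of 0] by (intro suminf_split_initial_segment summable_norm_cancel[of t]) simp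
  also have "(\<Sum>m<D. t m) = (\<Sum>d=1..D. f d / (of_nat d * of_nat (Suc d)))"
    unfolding shift by (simp add: t_def)
  finally have "norm (C_const f - (\<Sum>d=1..D. f d / (of_nat d * of_nat (Suc d)))) = norm (\<Sum>m. t (m + D))"
    by simp
  also have "\<dots> \<le> u D" using summable_norm[OF t(1)[of D]] t(2)[of D] by linarith
  finally show "norm (C_const f - (\<Sum>d=1..D. f d / (of_nat d * of_nat (Suc d))))
           \<le> 2 * K * real (Suc D) powr (\<eta> - 1)" by (simp add: u_def)
qed

text \<open>The coefficients produced by summation by parts from differences of consecutive values.
  The index range gains the endpoint \<open>Suc D\<close>, and the test \<open>d \<ge> 2\<close>
  keeps \<open>f 0\<close> out.\<close>

definition saw_coeff :: "(nat \<Rightarrow> complex) \<Rightarrow> nat \<Rightarrow> nat \<Rightarrow> complex" where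
  "saw_coeff f D d = (if d \<le> D then f d else 0) - (if d \<ge> 2 then f (d - 1) else 0)"

lemma sum_saw_coeff:
  "(\<Sum>d=1..Suc D. saw_coeff f D d * s d) = (\<Sum>d=1..D. f d * (s d - s (Suc d)))"
proof -
  have "(\<Sum>d=1..Suc D. saw_coeff f D d * s d)
      = (\<Sum>d=1..Suc D. (if d \<le> D then f d else 0) * s d) - (\<Sum>d=1..Suc D. (if d \<ge> 2 then f (d - 1) else 0) * s d)"
    by (simp only: saw_coeff_def left_diff_distrib sum_subtractf)
  also have "(\<Sum>d=1..Suc D. (if d \<le> D then f d else 0) * s d) = (\<Sum>d=1..D. f d * s d)"
    by simp
  also have "(\<Sum>d=1..Suc D. (if d \<ge> 2 then f (d - 1) else 0) * s d) = (\<Sum>d=2..Suc D. f (d - 1) * s d)"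
    by (intro sum.mono_neutral_cong_right) auto
  also have "\<dots> = (\<Sum>d=1..D. f d * s (Suc d))"
    by (rule sum.reindex_bij_witness[of _ Suc "\<lambda>d. d - 1"]) auto
  finally show ?thesis by (simp add: right_diff_distrib sum_subtractf)
qed

text \<open>In the difference of two consecutive quotients the constants -1/2 cancel, while N/d and
  1/(2d) leave (N + 1/2) times 1/(d(d+1)). The part with N is a partial sum of the main
  term.\<close>

lemma E_err_eq:
  "E_err f (real N) = (\<Sum>n=1..N div Suc D. f (N div n))
     + (\<Sum>d=1..Suc D. saw_coeff f D d * saw d N)
     + (\<Sum>d=1..D. f d / (of_nat d * of_nat (Suc d))) / 2
     - of_nat N * (C_const f - (\<Sum>d=1..D. f d / (of_nat d * of_nat (Suc d))))"
proof -
  have *: "f d * (of_nat (N div d) - of_nat (N div Suc d))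
      = f d * (saw d N - saw (Suc d) N) + (of_nat N + 1 / 2) * (f d / (of_nat d * of_nat (Suc d)))"
    if "d \<in> {1..D}" for d
  proof -
    define u v :: complex where "u = 1 / of_nat d" and "v = 1 / of_nat (Suc d)"
    have 1: "of_nat (N div d) = of_nat N * u + saw d N - 1 / 2 + u / 2"
      using that by (subst div_eq_saw) (auto simp: u_def)
    have 2: "of_nat (N div Suc d) = of_nat N * v + saw (Suc d) N - 1 / 2 + v / 2"
      by (subst div_eq_saw) (auto simp: v_def)
    have uv: "u - v = 1 / (of_nat d * of_nat (Suc d))"
      unfolding u_def v_def using that by (subst diff_frac_eq) (auto simp del: of_nat_Suc, simp)
    have "f d * (of_nat (N div d) - of_nat (N div Suc d))
        = f d * (saw d N - saw (Suc d) N) + (of_nat N + 1 / 2) * (f d * (u - v))"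
      unfolding 1 2 by (simp add: algebra_simps)
    then show ?thesis unfolding uv by simp
  qed
  have "S_sum f (real N) = (\<Sum>n=1..N. f (N div n))" by (simp add: S_sum_eq)
  also have "\<dots> = (\<Sum>n=1..N div Suc D. f (N div n))
           + (\<Sum>d=1..D. f d * (of_nat (N div d) - of_nat (N div Suc d)))"
    by (rule sum_div_hyperbola)
  also have "(\<Sum>d=1..D. f d * (of_nat (N div d) - of_nat (N div Suc d)))
      = (\<Sum>d=1..D. f d * (saw d N - saw (Suc d) N) + (of_nat N + 1 / 2) * (f d / (of_nat d * of_nat (Suc d))))"
    by (intro sum.cong refl *)
  also have "\<dots> = (\<Sum>d=1..Suc D. saw_coeff f D d * saw d N)
      + (of_nat N + 1 / 2) * (\<Sum>d=1..D. f d / (of_nat d * of_nat (Suc d)))"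
    by (simp only: sum.distrib sum_distrib_left sum_saw_coeff)
  finally show ?thesis by (simp only: E_err_def of_real_of_nat_eq) (simp add: algebra_simps)
qed

text \<open>In the factor 3, one unit pays for the at most X/(D+1) terms bounded trivially and two
  for the tail of \<open>C_const\<close>. The separate \<open>K\<close> bounds half of a partial sum
  of its series.\<close>

lemma norm_E_err_le:
  assumes \<eta>: "0 < \<eta>" "\<eta> \<le> 1 / 2" and K: "\<And>n. n \<ge> 1 \<Longrightarrow> norm (f n) \<le> K * real n powr \<eta>"
    and N: "real N \<le> X" and DX: "real (Suc D) \<le> X"
  shows "norm (E_err f (real N)) \<le> norm (\<Sum>d=1..Suc D. saw_coeff f D d * saw d N)
           + K + 3 * K * X powr (1 + \<eta>) / real (Suc D)"
proof -
  define c where "c = (\<Sum>d=1..D. f d / (of_nat d * of_nat (Suc d)))"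
  have K0: "K \<ge> 0" using order_trans[OF norm_ge_zero K[of 1]] by simp
  have X: "X > 0" using DX by simp
  have "norm (\<Sum>n=1..N div Suc D. f (N div n)) \<le> (\<Sum>n=1..N div Suc D. K * X powr \<eta>)"
  proof (rule sum_norm_le)
    fix n assume n: "n \<in> {1..N div Suc D}"
    then have "n \<le> N" using div_le_dividend[of N "Suc D"] by (simp del: div_le_dividend)
    then have 1: "N div n \<ge> 1" using n by (simp add: Suc_leI div_greater_zero_iff)
    have "real (N div n) \<le> X" using div_le_dividend[of N n] N by linarith
    then have "real (N div n) powr \<eta> \<le> X powr \<eta>" using \<eta> by (intro powr_mono2) auto
    then show "norm (f (N div n)) \<le> K * X powr \<eta>"
      using K[OF 1] K0 by (meson mult_left_mono order_trans)
  qed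
  also have "\<dots> = real (N div Suc D) * (K * X powr \<eta>)" by simp
  also have "\<dots> \<le> (X / real (Suc D)) * (K * X powr \<eta>)"
  proof (intro mult_right_mono)
    have "real (N div Suc D) \<le> real N / real (Suc D)" by (rule of_nat_div_le_of_nat)
    also have "\<dots> \<le> X / real (Suc D)" using N by (intro divide_right_mono) auto
    finally show "real (N div Suc D) \<le> X / real (Suc D)" .
  qed (use K0 in auto)
  also have "\<dots> = K * X powr (1 + \<eta>) / real (Suc D)" using X by (simp add: powr_add)
  finally have A: "norm (\<Sum>n=1..N div Suc D. f (N div n)) \<le> K * X powr (1 + \<eta>) / real (Suc D)" .

  have "norm c \<le> 2 * K" unfolding c_def by (rule order_trans[OF norm_sum C_const_tail(1)[OF \<eta> K]])
  then have Bc: "norm (c / 2) \<le> K" by (simp add: norm_divide)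

  have "norm (of_nat N * (C_const f - c)) \<le> X * (2 * K * real (Suc D) powr (\<eta> - 1))"
    unfolding norm_mult norm_of_nat c_def
    using N X by (intro mult_mono C_const_tail(2)[OF \<eta> K]) auto
  also have "\<dots> = 2 * K * X * real (Suc D) powr \<eta> / real (Suc D)"
    by (subst powr_diff) simp
  \<comment> \<open>\<open>DX\<close> enters here, giving the tail the same shape as the trivial
    bound.\<close>
  also have "\<dots> \<le> 2 * K * X * X powr \<eta> / real (Suc D)"
    using K0 X DX \<eta> by (intro divide_right_mono mult_left_mono powr_mono2) auto
  also have "\<dots> = 2 * K * X powr (1 + \<eta>) / real (Suc D)" using X by (simp add: powr_add)
  finally have Ct: "norm (of_nat N * (C_const f - c)) \<le> 2 * K * X powr (1 + \<eta>) / real (Suc D)" .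

  let ?M = "\<Sum>d=1..Suc D. saw_coeff f D d * saw d N"
  have "norm (E_err f (real N)) \<le> norm (\<Sum>n=1..N div Suc D. f (N div n)) + norm ?M
      + norm (c / 2) + norm (of_nat N * (C_const f - c))"
    unfolding E_err_eq[of f N D] c_def[symmetric]
    by (intro order_trans[OF norm_triangle_ineq4] add_mono order_trans[OF norm_triangle_ineq] order_refl)
  also have "\<dots> \<le> K * X powr (1 + \<eta>) / real (Suc D) + norm ?M + K + 2 * K * X powr (1 + \<eta>) / real (Suc D)"
    by (intro add_mono A Bc Ct order_refl)
  finally show ?thesis by (simp add: add_divide_distrib[symmetric] algebra_simps)
qed

lemma norm_saw_coeff_le:
  assumes "0 < \<eta>" and K: "\<And>n. n \<ge> 1 \<Longrightarrow> norm (f n) \<le> K * real n powr \<eta>" and d: "d \<in> {1..Suc D}"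
  shows "norm (saw_coeff f D d) \<le> 2 * K * real D powr \<eta>"
proof -
  have K0: "K \<ge> 0" using order_trans[OF norm_ge_zero K[of 1]] by simp
  have *: "norm (f n) \<le> K * real D powr \<eta>" if "1 \<le> n" "n \<le> D" for n
    using that assms(1) K0
    by (intro order_trans[OF K[OF that(1)]] mult_left_mono powr_mono2) auto
  have "norm (saw_coeff f D d) \<le> norm (if d \<le> D then f d else 0) + norm (if d \<ge> 2 then f (d - 1) else 0)"
    unfolding saw_coeff_def by (rule norm_triangle_ineq4)
  also have "\<dots> \<le> K * real D powr \<eta> + K * real D powr \<eta>"
    using d K0 by (intro add_mono) (auto intro!: *)
  finally show ?thesis by simp
qed

section \<open>The mean square of the error term\<close>

lemma E_err_floor:
  assumes "x \<ge> 0"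
  shows "E_err f x = S_sum f (real (nat \<lfloor>x\<rfloor>)) - C_const f * of_real x"
  using assms by (simp add: E_err_def S_sum_eq)

text \<open>\<open>S_sum\<close> takes the same value at \<open>x\<close> and at its integer part,
  so only the linear term moves, by at most \<open>norm (C_const f)\<close>.\<close>

lemma norm_E_err_floor_le:
  assumes "x \<ge> 0"
  shows "(norm (E_err f x))\<^sup>2 \<le> 2 * (norm (E_err f (real (nat \<lfloor>x\<rfloor>))))\<^sup>2 + 2 * (norm (C_const f))\<^sup>2"
proof -
  define N where "N = real (nat \<lfloor>x\<rfloor>)"
  have N: "\<bar>x - N\<bar> \<le> 1" using assms by (simp add: N_def) linarith
  have "E_err f x = E_err f N - C_const f * of_real (x - N)"
    using E_err_floor[OF assms, of f] by (simp add: E_err_def N_def algebra_simps)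
  then have "norm (E_err f x) \<le> norm (E_err f N) + norm (C_const f * of_real (x - N))"
    by (simp add: norm_triangle_ineq4)
  also have "norm (C_const f * of_real (x - N)) \<le> norm (C_const f) * 1"
    unfolding norm_mult norm_of_real using N by (intro mult_left_mono) auto
  finally have "(norm (E_err f x))\<^sup>2 \<le> (norm (E_err f N) + norm (C_const f))\<^sup>2"
    by (intro power_mono) auto
  also have "\<dots> \<le> 2 * (norm (E_err f N))\<^sup>2 + 2 * (norm (C_const f))\<^sup>2"
    using sum_squares_bound[of "norm (E_err f N)" "norm (C_const f)"] by (simp add: power2_sum)
  finally show ?thesis by (simp add: N_def)
qed

text \<open>The step function \<open>G\<close>, constant on each [N, N + 1), dominates the
  integrand. These intervals have length 1, so its integral is the sum of its values.\<close>

lemma integral_E_err_le: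
  assumes T: "T \<ge> 0"
  defines "I \<equiv> {nat \<lfloor>T\<rfloor>..nat \<lfloor>2 * T\<rfloor>}"
  shows "set_integrable lborel {T..2 * T} (\<lambda>x. (norm (E_err f x))\<^sup>2)"
    and "(LINT x:{T..2 * T}|lborel. (norm (E_err f x))\<^sup>2)
           \<le> (\<Sum>N\<in>I. 2 * (norm (E_err f (real N)))\<^sup>2 + 2 * (norm (C_const f))\<^sup>2)"
proof -
  let ?J = "\<lambda>N. {real N..<real N + 1}"
  define b where "b N = 2 * (norm (E_err f (real N)))\<^sup>2 + 2 * (norm (C_const f))\<^sup>2" for N :: nat
  define G where "G x = (\<Sum>N\<in>I. indicator (?J N) x *\<^sub>R b N)" for x
  define h where "h x = indicator {T..2 * T} x *\<^sub>R (norm (E_err f x))\<^sup>2" for x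
  have "finite I" by (simp add: I_def)
  \<comment> \<open>Exactly one unit interval contains \<open>x\<close>. The values are arbitrary
    vectors because this serves both the real \<open>b\<close> and the complex
    \<open>S_sum\<close>.\<close>
  have unique: "(\<Sum>N\<in>I. indicator (?J N) x *\<^sub>R v N) = v (nat \<lfloor>x\<rfloor>)"
    if x: "x \<in> {T..2 * T}" for x and v :: "nat \<Rightarrow> 'b::real_vector"
  proof -
    have "nat \<lfloor>x\<rfloor> \<in> I" using x by (auto simp: I_def intro!: nat_mono floor_mono)
    moreover have J: "x \<in> ?J N \<longleftrightarrow> N = nat \<lfloor>x\<rfloor>" for N
    proof -
      have "x \<in> ?J N \<longleftrightarrow> \<lfloor>x\<rfloor> = int N" by (auto simp: floor_eq_iff)
      then show ?thesis using x T by auto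
    qed
    have "(\<Sum>N\<in>I. indicator (?J N) x *\<^sub>R v N) = (\<Sum>N\<in>I. if N = nat \<lfloor>x\<rfloor> then v N else 0)"
      unfolding indicator_def J by (intro sum.cong refl) simp
    ultimately show ?thesis using \<open>finite I\<close> by simp
  qed
  have int_ind: "integrable lborel (indicator (?J N) :: real \<Rightarrow> real)" for N
    by (simp add: integrable_indicator_iff)
  have G_int: "integrable lborel G" unfolding G_def
    by (intro Bochner_Integration.integrable_sum integrable_scaleR_left int_ind)
  have hG: "norm (h x) \<le> G x" for x
  proof (cases "x \<in> {T..2 * T}")
    case True
    then have "G x = b (nat \<lfloor>x\<rfloor>)" unfolding G_def by (rule unique)
    then show ?thesis using norm_E_err_floor_le[of x f] True T by (simp add: h_def b_def)
  next
    case False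
    then show ?thesis by (auto simp: h_def G_def b_def intro!: sum_nonneg)
  qed
  \<comment> \<open>Measurability: on the range of integration \<open>S_sum\<close> is a finite
    combination of indicators.\<close>
  have "h = (\<lambda>x. indicator {T..2 * T} x *\<^sub>R
      (norm ((\<Sum>N\<in>I. indicator (?J N) x *\<^sub>R S_sum f (real N)) - C_const f * of_real x))\<^sup>2)"
  proof
    fix x
    show "h x = indicator {T..2 * T} x *\<^sub>R
      (norm ((\<Sum>N\<in>I. indicator (?J N) x *\<^sub>R S_sum f (real N)) - C_const f * of_real x))\<^sup>2"
      using unique[of x "\<lambda>N. S_sum f (real N)"] E_err_floor[of x f] T
      by (cases "x \<in> {T..2 * T}") (auto simp: h_def)
  qed
  also have "\<dots> \<in> borel_measurable lborel" by measurable
  finally have h_meas: "h \<in> borel_measurable lborel" .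
  have h_int: "integrable lborel h"
  proof (rule Bochner_Integration.integrable_bound[OF G_int h_meas])
    have "norm (h x) \<le> norm (G x)" for x
      using hG[of x] unfolding real_norm_def by linarith
    then show "AE x in lborel. norm (h x) \<le> norm (G x)" by simp
  qed
  then show "set_integrable lborel {T..2 * T} (\<lambda>x. (norm (E_err f x))\<^sup>2)"
    unfolding set_integrable_def by (simp only: h_def[abs_def])
  have "(LINT x:{T..2 * T}|lborel. (norm (E_err f x))\<^sup>2) = integral\<^sup>L lborel h"
    unfolding set_lebesgue_integral_def by (simp only: h_def[abs_def])
  also have "\<dots> \<le> integral\<^sup>L lborel G"
    using hG by (intro integral_mono h_int G_int) (auto simp: abs_le_iff)
  also have "\<dots> = (\<Sum>N\<in>I. (integral\<^sup>L lborel (indicator (?J N) :: real \<Rightarrow> real)) *\<^sub>R b N)"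
    unfolding G_def
    by (subst Bochner_Integration.integral_sum) (auto intro!: integrable_scaleR_left int_ind)
  also have "\<dots> = (\<Sum>N\<in>I. b N)" by simp
  finally show "(LINT x:{T..2 * T}|lborel. (norm (E_err f x))\<^sup>2)
           \<le> (\<Sum>N\<in>I. 2 * (norm (E_err f (real N)))\<^sup>2 + 2 * (norm (C_const f))\<^sup>2)"
    by (simp add: b_def)
qed

text \<open>The sequence harm n - ln n decreases from 1, and the logarithm is at most
  n^\<eta>/\<eta>.\<close>

lemma harm_le_powr:
  assumes n: "n \<ge> 1" and \<eta>: "\<eta> > 0"
  shows "harm n \<le> (1 + 1 / \<eta>) * real n powr \<eta>"
proof -
  have "harm n - ln (real n) \<le> harm 1 - ln (real 1)"
    using n by (intro euler_mascheroni_sequence_decreasing) auto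
  moreover have "harm 1 = (1 :: real)" by (simp add: harm_def)
  ultimately have "harm n \<le> 1 + ln (real n)" by (simp only: of_nat_1 ln_one)
  moreover have "ln (real n) \<le> real n powr \<eta> / \<eta>" using n \<eta> by (intro ln_powr_bound) auto
  moreover have "1 \<le> real n powr \<eta>" using n \<eta> by (intro ge_one_powr_ge_zero) auto
  ultimately show ?thesis by (simp add: algebra_simps)
qed

text \<open>Of the loss 4\<eta>, half comes from the squared coefficient bound and half from the
  squared harmonic sum.\<close>

lemma sum_norm_E_err_le:
  assumes \<eta>: "0 < \<eta>" "\<eta> \<le> 1 / 2" and K: "\<And>n. n \<ge> 1 \<Longrightarrow> norm (f n) \<le> K * real n powr \<eta>"
    and T: "T \<ge> 10"
  shows "(\<Sum>N\<in>{nat \<lfloor>T\<rfloor>..nat \<lfloor>2 * T\<rfloor>}. (norm (E_err f (real N)))\<^sup>2)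
           \<le> (480 * K\<^sup>2 * (1 + 1 / \<eta>)\<^sup>2 + 676 * K\<^sup>2) * T powr (9 / 5 + 4 * \<eta>)"
proof -
  define D where "D = nat \<lfloor>T powr (3 / 5)\<rfloor>"
  define y where "y = nat \<lfloor>T\<rfloor>"
  define z where "z = nat \<lfloor>2 * T\<rfloor>"
  \<comment> \<open>The square meets the sieve condition for denominators up to
    \<open>Suc D\<close>; the extra \<open>y + 2\<close> makes the window cover all of
    \<open>{y..z}\<close>, since z < 2y + 2.\<close>
  define Q where "Q = (Suc D)\<^sup>2 + y + 2"
  define M where "M N = norm (\<Sum>d=1..Suc D. saw_coeff f D d * saw d N)" for N
  have K0: "K \<ge> 0" using order_trans[OF norm_ge_zero K[of 1]] by simp
  have T1: "1 \<le> T powr a" if "a \<ge> 0" for a using T that by (intro ge_one_powr_ge_zero) auto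
  have D1: "real D \<le> T powr (3 / 5)" "T powr (3 / 5) \<le> real (Suc D)"
    by (simp_all add: D_def) linarith
  have T35: "T powr (3 / 5) \<le> T" using T powr_mono[of "3 / 5" 1 T] by simp
  have D2: "real (Suc D) \<le> 2 * T powr (3 / 5)" using D1(1) T1[of "3 / 5"] by simp
  have D3: "real (Suc D) \<le> 2 * T" using D2 T35 by linarith
  have y: "real y \<le> T" "T < real y + 1" using T by (auto simp: y_def)
  have z: "real z \<le> 2 * T" "2 * T < real z + 1" using T by (auto simp: z_def)

  have Q: "real Q \<le> 6 * T powr (6 / 5)"
  proof -
    have "(real (Suc D))\<^sup>2 \<le> (2 * T powr (3 / 5))\<^sup>2" by (intro power_mono D2) auto
    also have "\<dots> = 4 * T powr (6 / 5)" using T by (simp add: power_mult_distrib powr_power)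
    finally have "(real (Suc D))\<^sup>2 \<le> 4 * T powr (6 / 5)" .
    moreover have "T \<le> T powr (6 / 5)" using T powr_mono[of 1 "6 / 5" T] by simp
    ultimately show ?thesis using y T by (simp add: Q_def)
  qed

  \<comment> \<open>The trivial error T^(1+\<eta>)/D has size T^(2/5+\<eta>). The constants are 13 =
    1 + 12 and 338 = 2 * 13^2.\<close>
  have pointwise: "(norm (E_err f (real N)))\<^sup>2 \<le> 2 * (M N)\<^sup>2 + 338 * K\<^sup>2 * T powr (4 / 5 + 2 * \<eta>)"
    if N: "N \<in> {y..z}" for N
  proof -
    have "(2 * T) powr (1 + \<eta>) = 2 powr (1 + \<eta>) * T powr (1 + \<eta>)"
      using T by (simp add: powr_mult)
    also have "\<dots> \<le> 2 powr 2 * T powr (1 + \<eta>)" using \<eta> by (intro mult_right_mono powr_mono) auto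
    finally have "(2 * T) powr (1 + \<eta>) \<le> 4 * T powr (1 + \<eta>)" by simp
    then have "3 * K * (2 * T) powr (1 + \<eta>) / real (Suc D) \<le> 3 * K * (4 * T powr (1 + \<eta>)) / T powr (3 / 5)"
      using K0 D1 T by (intro frac_le mult_left_mono) auto
    also have "\<dots> = 12 * K * (T powr (1 + \<eta>) / T powr (3 / 5))" by simp
    also have "T powr (1 + \<eta>) / T powr (3 / 5) = T powr (2 / 5 + \<eta>)"
      by (subst powr_diff[symmetric], rule arg_cong[where f = "(powr) T"]) simp
    finally have 1: "3 * K * (2 * T) powr (1 + \<eta>) / real (Suc D) \<le> 12 * K * T powr (2 / 5 + \<eta>)" .
    have "K * 1 \<le> K * T powr (2 / 5 + \<eta>)" using \<eta> K0 by (intro mult_left_mono T1) auto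
    moreover have "norm (E_err f (real N)) \<le> M N + K + 3 * K * (2 * T) powr (1 + \<eta>) / real (Suc D)"
      unfolding M_def using N z D3 by (intro norm_E_err_le[OF \<eta> K]) auto
    ultimately have "norm (E_err f (real N)) \<le> M N + 13 * K * T powr (2 / 5 + \<eta>)" using 1 by simp
    then have "(norm (E_err f (real N)))\<^sup>2 \<le> (M N + 13 * K * T powr (2 / 5 + \<eta>))\<^sup>2"
      by (intro power_mono) auto
    also have "\<dots> \<le> 2 * (M N)\<^sup>2 + 2 * (13 * K * T powr (2 / 5 + \<eta>))\<^sup>2"
      using sum_squares_bound[of "M N" "13 * K * T powr (2 / 5 + \<eta>)"] by (simp add: power2_sum)
    also have "(13 * K * T powr (2 / 5 + \<eta>))\<^sup>2 = 169 * K\<^sup>2 * T powr (4 / 5 + 2 * \<eta>)"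
      using T by (simp add: power_mult_distrib powr_power algebra_simps)
    finally show ?thesis by simp
  qed

  have "(\<Sum>N\<in>{y..z}. (M N)\<^sup>2) = (\<Sum>n\<in>{..z - y}. (M (y + n))\<^sup>2)"
    using y z by (intro sum.reindex_bij_witness[of _ "\<lambda>n. y + n" "\<lambda>N. N - y"]) auto
  also have "\<dots> \<le> (\<Sum>n<Q. (M (y + n))\<^sup>2)"
  proof (intro sum_mono2)
    have "real z < real (2 * y + 2)" using y z by simp
    then have "z < 2 * y + 2" by linarith
    then show "{..z - y} \<subseteq> {..<Q}" by (auto simp: Q_def)
  qed auto
  also have "\<dots> \<le> 5 / 4 * real Q * real (Suc D) * (2 * K * real D powr \<eta> * harm (Suc D))\<^sup>2"
    unfolding M_def
    by (intro mean_square_saw norm_saw_coeff_le[OF \<eta>(1) K]) (auto simp: Q_def)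
  also have "\<dots> \<le> 5 / 4 * (6 * T powr (6 / 5)) * (2 * T powr (3 / 5)) *
      (2 * K * T powr \<eta> * (2 * (1 + 1 / \<eta>) * T powr \<eta>))\<^sup>2"
  proof -
    have "real D powr \<eta> \<le> T powr \<eta>" using D1 T35 \<eta> by (intro powr_mono2) auto
    moreover have "harm (Suc D) \<le> 2 * (1 + 1 / \<eta>) * T powr \<eta>"
    proof -
      have "harm (Suc D) \<le> (1 + 1 / \<eta>) * real (Suc D) powr \<eta>" using \<eta> by (intro harm_le_powr) auto
      also have "\<dots> \<le> (1 + 1 / \<eta>) * (2 * T) powr \<eta>"
        using D3 \<eta> by (intro mult_left_mono powr_mono2) auto
      also have "\<dots> = (1 + 1 / \<eta>) * (2 powr \<eta> * T powr \<eta>)" using T by (simp add: powr_mult)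
      also have "\<dots> \<le> (1 + 1 / \<eta>) * (2 powr 1 * T powr \<eta>)"
        using \<eta> by (intro mult_left_mono mult_right_mono powr_mono) auto
      also have "\<dots> = 2 * (1 + 1 / \<eta>) * T powr \<eta>" by simp
      finally show ?thesis .
    qed
    moreover have "0 \<le> (harm (Suc D) :: real)" by (rule harm_nonneg)
    ultimately have "2 * K * real D powr \<eta> * harm (Suc D)
        \<le> 2 * K * T powr \<eta> * (2 * (1 + 1 / \<eta>) * T powr \<eta>)"
      using K0 by (intro mult_mono mult_nonneg_nonneg powr_ge_zero order_refl) auto
    then have "(2 * K * real D powr \<eta> * harm (Suc D))\<^sup>2
        \<le> (2 * K * T powr \<eta> * (2 * (1 + 1 / \<eta>) * T powr \<eta>))\<^sup>2"
      using K0 by (intro power_mono mult_nonneg_nonneg harm_nonneg) auto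
    then show ?thesis
      using Q D2 by (intro mult_mono order_refl mult_nonneg_nonneg zero_le_power2) auto
  qed
  also have "\<dots> = 240 * K\<^sup>2 * (1 + 1 / \<eta>)\<^sup>2 * (T powr (6 / 5) * T powr (3 / 5) * (T powr \<eta> * T powr \<eta>)\<^sup>2)"
    by (simp add: power2_eq_square) (simp add: algebra_simps)
  also have "T powr (6 / 5) * T powr (3 / 5) * (T powr \<eta> * T powr \<eta>)\<^sup>2 = T powr (9 / 5 + 4 * \<eta>)"
    by (simp only: powr_add[symmetric] power2_eq_square) simp
  finally have MM: "(\<Sum>N\<in>{y..z}. (M N)\<^sup>2) \<le> 240 * K\<^sup>2 * (1 + 1 / \<eta>)\<^sup>2 * T powr (9 / 5 + 4 * \<eta>)" .

  have "(\<Sum>N\<in>{y..z}. (norm (E_err f (real N)))\<^sup>2)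
      \<le> (\<Sum>N\<in>{y..z}. 2 * (M N)\<^sup>2 + 338 * K\<^sup>2 * T powr (4 / 5 + 2 * \<eta>))"
    by (intro sum_mono pointwise)
  also have "\<dots> = 2 * (\<Sum>N\<in>{y..z}. (M N)\<^sup>2) + real (card {y..z}) * (338 * K\<^sup>2 * T powr (4 / 5 + 2 * \<eta>))"
    by (simp add: sum.distrib sum_distrib_left)
  \<comment> \<open>The range holds at most T + 2 integers, hence at most 2T.\<close>
  also have "\<dots> \<le> 2 * (240 * K\<^sup>2 * (1 + 1 / \<eta>)\<^sup>2 * T powr (9 / 5 + 4 * \<eta>))
      + 2 * T * (338 * K\<^sup>2 * T powr (4 / 5 + 2 * \<eta>))"
    using MM y z T by (intro add_mono mult_left_mono mult_right_mono) (auto simp: of_nat_diff)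
  also have "2 * T * (338 * K\<^sup>2 * T powr (4 / 5 + 2 * \<eta>)) = 676 * K\<^sup>2 * T powr (9 / 5 + 2 * \<eta>)"
  proof -
    have "T * T powr (4 / 5 + 2 * \<eta>) = T powr (9 / 5 + 2 * \<eta>)"
      using T powr_add[of T 1 "4 / 5 + 2 * \<eta>"] by simp
    then show ?thesis by simp
  qed
  also have "\<dots> \<le> 676 * K\<^sup>2 * T powr (9 / 5 + 4 * \<eta>)"
    using \<eta> T by (intro mult_left_mono powr_mono) auto
  finally have "(\<Sum>N\<in>{y..z}. (norm (E_err f (real N)))\<^sup>2)
      \<le> (480 * K\<^sup>2 * (1 + 1 / \<eta>)\<^sup>2 + 676 * K\<^sup>2) * T powr (9 / 5 + 4 * \<eta>)"
    by (simp add: algebra_simps)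
  then show ?thesis by (simp add: y_def z_def)
qed

theorem theorem1:
  fixes f :: "nat \<Rightarrow> complex" and \<epsilon> :: real
  assumes "small_arith f" and "\<epsilon> > 0"
  shows "\<exists>K::real. \<forall>T::real. T \<ge> 10 \<longrightarrow>
           set_integrable lborel {T..2 * T} (\<lambda>x. (norm (E_err f x))\<^sup>2) \<and>
           (LINT x:{T..2 * T}|lborel. (norm (E_err f x))\<^sup>2) \<le> K * T powr (9 / 5 + \<epsilon>)"
proof -
  \<comment> \<open>The cap 1/2 is required by the tail estimate for \<open>C_const\<close>;
    \<epsilon>/4 absorbs the loss 4\<eta>.\<close>
  define \<eta> where "\<eta> = min (1 / 2) (\<epsilon> / 4)"
  have \<eta>: "0 < \<eta>" "\<eta> \<le> 1 / 2" "4 * \<eta> \<le> \<epsilon>" using assms(2) by (auto simp: \<eta>_def)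
  obtain K where K: "\<And>n. n \<ge> 1 \<Longrightarrow> norm (f n) \<le> K * real n powr \<eta>"
    using assms(1) \<eta>(1) unfolding small_arith_def by blast
  define A where "A = 480 * K\<^sup>2 * (1 + 1 / \<eta>)\<^sup>2 + 676 * K\<^sup>2"
  define B where "B = 2 * (norm (C_const f))\<^sup>2"
  have AB: "A \<ge> 0" "B \<ge> 0" by (auto simp: A_def B_def)
  show ?thesis
  proof (intro exI[of _ "2 * A + 2 * B"] allI impI conjI)
    fix T :: real
    assume T: "T \<ge> 10"
    let ?I = "{nat \<lfloor>T\<rfloor>..nat \<lfloor>2 * T\<rfloor>}"
    show "set_integrable lborel {T..2 * T} (\<lambda>x. (norm (E_err f x))\<^sup>2)"
      using T by (intro integral_E_err_le) auto
    have "(LINT x:{T..2 * T}|lborel. (norm (E_err f x))\<^sup>2)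
        \<le> (\<Sum>N\<in>?I. 2 * (norm (E_err f (real N)))\<^sup>2 + B)"
      unfolding B_def using T by (intro integral_E_err_le) auto
    also have "\<dots> = 2 * (\<Sum>N\<in>?I. (norm (E_err f (real N)))\<^sup>2) + real (card ?I) * B"
      by (simp add: sum.distrib sum_distrib_left)
    also have "\<dots> \<le> 2 * (A * T powr (9 / 5 + 4 * \<eta>)) + 2 * T * B"
    proof (intro add_mono mult_left_mono mult_right_mono)
      show "real (card ?I) \<le> 2 * T" using T by (simp add: of_nat_diff) linarith
    qed (use sum_norm_E_err_le[OF \<eta>(1,2) K T] AB in \<open>auto simp: A_def\<close>)
    \<comment> \<open>The rounding contribution \<open>B\<close> is only of order T, well below
      T^(9/5).\<close>
    also have "\<dots> \<le> 2 * (A * T powr (9 / 5 + \<epsilon>)) + 2 * T powr (9 / 5 + \<epsilon>) * B"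
    proof (intro add_mono mult_left_mono mult_right_mono)
      show "T powr (9 / 5 + 4 * \<eta>) \<le> T powr (9 / 5 + \<epsilon>)" using T \<eta> by (intro powr_mono) auto
      show "T \<le> T powr (9 / 5 + \<epsilon>)" using T assms(2) powr_mono[of 1 "9 / 5 + \<epsilon>" T] by simp
    qed (use AB in auto)
    finally show "(LINT x:{T..2 * T}|lborel. (norm (E_err f x))\<^sup>2)
        \<le> (2 * A + 2 * B) * T powr (9 / 5 + \<epsilon>)" by (simp add: algebra_simps)
  qed
qed

end
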